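(* Let $\mathbb{E}$ be a one-face embedding of a graph $G$ and let $v$ be a vertex of $G$ with degree $deg(v)=k$. Let $v=(s_v,\pi_v)$ and suppose $D_v=s_v\circ\pi_v^{-1}$ is of cycle-type $\lambda=(1^{a_1},2^{a_2},\ldots,k^{a_k})$. Then the probability $prob_1(v)$ that the embedding resulting from (uniformly) randomly rearranging the half edges around $v$ is unicellular satisfies $$\frac{2}{deg(v)-a_1+2}\le prob_1(v)\le \frac{2}{deg(v)-a_1+\frac{19}{29}}.$$ In particular, for any vertex $v$, $prob_1(v)\ge \frac{2}{deg(v)+2}$.
   Context: Graphs are finite and connected with at least one edge, loops and multiple edges allowed. An embedding is a 2-cell embedding on a closed orientable surface. Permutations are composed right to left, and fixed points count as cycles. An embedding $\mathbb{E}$ of $G$ with $e$ edges is encoded by a triple $(\alpha,\beta,\gamma)$ of permutations of the set $[2e]$ of half edges (each edge consists of two half edges): $\alpha$ is the fixed-point-free involution pairing the two half edges of each edge; the cycles of $\beta$ are the vertices, each cycle listing the half edges incident to that vertex in counterclockwise cyclic order; $\gamma=\alpha\beta$, and its cycles are the faces. The embedding is one-face (unicellular) if $\gamma$ is a single cycle. Write $s=\gamma$, $\pi=\beta$. For a vertex $v$, $H(v)$ is the set of half edges incident to $v$ and $deg(v)=|H(v)|$. In a one-face embedding, $s_v$ is the cycle on $H(v)$ obtained from $s$ by deleting all elements not in $H(v)$, and $\pi_v$ is the restriction of $\pi$ to $H(v)$ (a single cycle). Rearranging the half edges around $v$ according to a cyclic order $\theta$ on $H(v)$ means replacing the cycle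 of $\beta$ on $H(v)$ by $\theta$, keeping $\alpha$ and all other cycles of $\beta$. The random rearrangement is uniform over all $(deg(v)-1)!$ cyclic orders on $H(v)$ (including the original one). The cycle-type notation $(1^{a_1},\ldots,k^{a_k})$ means $a_i$ cycles of length $i$. *)

theory Defs
  imports "HOL-Combinatorics.Orbits" "HOL-Probability.Probability_Mass_Function"
begin

text \<open>
  Multigraphs with loops are given by half edges: a graph with \<open>e\<close> edges has the half edges
  \<open>1, \<dots>, 2 e\<close>; \<open>opposite\<close> pairs the two half edges of each edge, and \<open>endpoint\<close> sends a half
  edge to the vertex it is incident to. A loop is an edge whose two half edges have the same
  endpoint, so it contributes 2 to the degree.
\<close>

record 'v half_edge_graph =
  verts :: "'v set"
  num_edges :: nat
  opposite :: "nat \<Rightarrow> nat"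
  endpoint :: "nat \<Rightarrow> 'v"

definition half_edges :: "'v half_edge_graph \<Rightarrow> nat set" where
  "half_edges G = {1..2 * num_edges G}"

definition is_graph :: "'v half_edge_graph \<Rightarrow> bool" where
  "is_graph G \<longleftrightarrow>
     finite (verts G) \<and> num_edges G \<ge> 1 \<and>
     endpoint G ` half_edges G \<subseteq> verts G \<and>
     opposite G permutes half_edges G \<and>
     (\<forall>h\<in>half_edges G. opposite G h \<noteq> h \<and> opposite G (opposite G h) = h) \<and>
     (\<forall>u\<in>verts G. \<forall>w\<in>verts G.
        (u, w) \<in> {(endpoint G h, endpoint G (opposite G h)) | h. h \<in> half_edges G}\<^sup>*)"

definition incident :: "'v half_edge_graph \<Rightarrow> 'v \<Rightarrow> nat set" where
  "incident G v = {h \<in> half_edges G. endpoint G h = v}"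

definition deg :: "'v half_edge_graph \<Rightarrow> 'v \<Rightarrow> nat" where
  "deg G v = card (incident G v)"

text \<open>
  The triple \<open>(\<alpha>, \<beta>, \<gamma>)\<close> of permutations of the half edges encoding a 2-cell embedding in a
  closed orientable surface. Each permutation is the identity outside the half edges.
\<close>

record embedding =
  edge_perm :: "nat \<Rightarrow> nat"
  vertex_perm :: "nat \<Rightarrow> nat"
  face_perm :: "nat \<Rightarrow> nat"

definition embedding_of :: "'v half_edge_graph \<Rightarrow> embedding \<Rightarrow> bool" where
  "embedding_of G E \<longleftrightarrow>
     edge_perm E = opposite G \<and>
     vertex_perm E permutes half_edges G \<and>
     (\<forall>v\<in>verts G. cyclic_on (vertex_perm E) (incident G v)) \<and>
     face_perm E = edge_perm E \<circ> vertex_perm E"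

definition one_face :: "'v half_edge_graph \<Rightarrow> embedding \<Rightarrow> bool" where
  "one_face G E \<longleftrightarrow> cyclic_on (face_perm E) (half_edges G)"

text \<open>
  Deleting from the cycles of \<open>f\<close> all elements outside \<open>S\<close>: each element of \<open>S\<close> is sent to the
  next element of \<open>S\<close> on its cycle. The least \<open>n\<close> exists whenever \<open>f\<close> permutes a finite set.
\<close>

definition delete_outside :: "('a \<Rightarrow> 'a) \<Rightarrow> 'a set \<Rightarrow> 'a \<Rightarrow> 'a" where
  "delete_outside f S x =
     (if x \<in> S then (f ^^ (LEAST n. n > 0 \<and> (f ^^ n) x \<in> S)) x else x)"

definition s_at :: "'v half_edge_graph \<Rightarrow> embedding \<Rightarrow> 'v \<Rightarrow> nat \<Rightarrow> nat" where
  "s_at G E v = delete_outside (face_perm E) (incident G v)"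

definition pi_at :: "'v half_edge_graph \<Rightarrow> embedding \<Rightarrow> 'v \<Rightarrow> nat \<Rightarrow> nat" where
  "pi_at G E v = perm_restrict (vertex_perm E) (incident G v)"

definition D_at :: "'v half_edge_graph \<Rightarrow> embedding \<Rightarrow> 'v \<Rightarrow> nat \<Rightarrow> nat" where
  "D_at G E v = s_at G E v \<circ> inv (pi_at G E v)"

text \<open>
  The permutation \<open>f\<close> of the finite set \<open>S\<close> has cycle type \<open>(1\<^bsup>a 1\<^esup>, \<dots>, k\<^bsup>a k\<^esup>)\<close>
  with \<open>k = card S\<close>. Fixed points are cycles, as \<open>orbit f x = {x}\<close> when \<open>f x = x\<close>. Values of
  \<open>a\<close> outside \<open>{1..k}\<close> are irrelevant.
\<close>

definition has_cycle_type :: "('a \<Rightarrow> 'a) \<Rightarrow> 'a set \<Rightarrow> (nat \<Rightarrow> nat) \<Rightarrow> bool" where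
  "has_cycle_type f S a \<longleftrightarrow>
     f permutes S \<and> (\<forall>i\<in>{1..card S}. card {C \<in> orbit f ` S. card C = i} = a i)"

definition cyclic_orders :: "'a set \<Rightarrow> ('a \<Rightarrow> 'a) set" where
  "cyclic_orders S = {\<theta>. \<theta> permutes S \<and> cyclic_on \<theta> S}"

definition rearrange ::
  "'v half_edge_graph \<Rightarrow> embedding \<Rightarrow> 'v \<Rightarrow> (nat \<Rightarrow> nat) \<Rightarrow> embedding" where
  "rearrange G E v \<theta> =
     (let \<beta> = override_on (vertex_perm E) \<theta> (incident G v)
      in \<lparr>edge_perm = edge_perm E, vertex_perm = \<beta>, face_perm = edge_perm E \<circ> \<beta>\<rparr>)"

definition prob1 :: "'v half_edge_graph \<Rightarrow> embedding \<Rightarrow> 'v \<Rightarrow> real" where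
  "prob1 G E v =
     measure_pmf.prob (pmf_of_set (cyclic_orders (incident G v)))
       {\<theta>. one_face G (rearrange G E v \<theta>)}"

end

theory Submission
  imports Defs
begin

text \<open>
Rearranging the half edges around \<open>v\<close> by \<open>\<theta>\<close> multiplies the face permutation \<open>\<gamma>\<close> by
\<open>\<pi>\<^sub>v\<inverse> \<theta>\<close>, a permutation of \<open>H(v)\<close>. Deleting everything outside \<open>H(v)\<close> commutes with such a
multiplication, and no face of the new embedding avoids \<open>H(v)\<close>, since it would have been a face
before, while the only face before contains \<open>H(v)\<close>. Hence the new embedding is unicellular iff \<open>D \<theta>\<close> is a single cycle on \<open>H(v)\<close>, where
\<open>D = D\<^sub>v\<close>, and the probability is the proportion of \<open>k\<close>-cycles \<open>\<theta>\<close> for which \<open>D \<theta>\<close> is a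
\<open>k\<close>-cycle (\<open>one_face_rearrange_iff\<close>, \<open>prob1_eq_cycle_integral\<close>).

This proportion depends only on the cycle lengths of \<open>D\<close>. By a formula of Boccara it is half the
integral over \<open>[-1, 1]\<close> of the product of the polynomials
\<open>h\<^sub>n(t) = ((1 + t) / 2)\<^sup>n - ((t - 1) / 2)\<^sup>n\<close>, one for each cycle, with \<open>n\<close> the length of the
cycle (\<open>cyclic_count_eq_cycle_integral\<close>). The proof is an induction on \<open>k\<close>. Deleting an element \<open>x\<close>
from both \<open>\<theta>\<close> and \<open>D \<theta>\<close> and recording \<open>b = \<theta> x\<close> gives a recursion for the count
(\<open>cyclic_count_rec\<close>). If \<open>x\<close> is not a fixed point of \<open>D\<close>, then for each \<open>b\<close> the cycle of \<open>D\<close>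
through \<open>x\<close>, of length \<open>l + 1\<close>, loses \<open>x\<close> and is either split into two cycles of lengths \<open>j\<close> and
\<open>l - j\<close>, or merged with another cycle. The integral satisfies the same recursion because the difference of the two sides has the integrand
\<open>d/dt ((t\<^sup>2 - 1) / 2 * h\<^sub>l G)\<close>, with \<open>G\<close> the product over the other cycles
(\<open>cyc_poly_integral_rec\<close>).

The original rotation at \<open>v\<close> is a favourable \<open>\<theta>\<close>, so the integral is not zero, which forces the
integrand to be even, and it suffices to integrate over \<open>[0, 1]\<close>. Let \<open>m = k - a\<^sub>1\<close>; fixed points
contribute the factor \<open>h\<^sub>1 = 1\<close>. Put \<open>X = (1 + t) / 2\<close> and \<open>Y = (1 - t) / 2\<close>, so that
\<open>X + Y = 1\<close> and \<open>X\<^sup>2 - Y\<^sup>2 = t\<close>.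

Lower bound: \<open>h\<^sub>n \<ge> (X\<^sup>2 - Y\<^sup>2)\<^bsup>n/2\<^esup> = t\<^bsup>n/2\<^esup>\<close> for \<open>n \<ge> 2\<close>, so the integral is at least that of
\<open>t\<^bsup>m/2\<^esup>\<close>, which is \<open>2 / (m + 2)\<close>.

Upper bound: let \<open>p\<^sub>n = X\<^sup>n + Y\<^sup>n\<close>. An odd cycle contributes \<open>p\<^sub>n\<close>, two even cycles of lengths \<open>a\<close> and
\<open>b\<close> together at most \<open>p\<^bsub>a+b\<^esub>\<close>, and among products of \<open>p\<close>'s with indices at least 3 and given
index sum \<open>m\<close> the largest is the one with as many factors \<open>p\<^sub>3\<close> as possible, namely \<open>p\<^sub>3\<^sup>u p\<^sub>r\<close> with \<open>r\<close> in \<open>{3, 4, 5}\<close>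
(\<open>cycle_bound\<close>). Integration by parts gives recurrences for the integrals of these functions, from
which the bound \<open>2 / (m + 19/29)\<close> follows by induction. The constant is the one for three 3-cycles:
the integral of \<open>p\<^sub>3\<^sup>3\<close> is \<open>29/140 = 2 / (9 + 19/29)\<close>, and every other case is strictly better.
\<close>

hide_const (open) Finite_Cartesian_Product.transpose

section \<open>Cycles written as lists\<close>

text \<open>
A cycle is recorded as the list of its elements in cyclic order. This makes cutting a cycle at two
places, or pasting two cycles together, a matter of list concatenation.
\<close>

definition cycle_list :: "('a \<Rightarrow> 'a) \<Rightarrow> 'a list \<Rightarrow> bool" where
  "cycle_list f xs \<longleftrightarrow>
     xs \<noteq> [] \<and> distinct xs \<and> successively (\<lambda>a b. f a = b) xs \<and> f (last xs) = hd xs"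

lemma cycle_list_cong:
  assumes "\<And>y. y \<in> set xs \<Longrightarrow> f y = g y"
  shows "cycle_list f xs \<longleftrightarrow> cycle_list g xs"
  unfolding cycle_list_def using assms by (auto intro!: successively_cong)

lemma orbit_cycle_list:
  assumes "cycle_list f xs"
  shows "orbit f (hd xs) = set xs"
proof
  have closed: "f y \<in> set xs" if "y \<in> set xs" for y
  proof -
    obtain us vs where "xs = us @ y # vs" using \<open>y \<in> set xs\<close> by (meson split_list)
    then show ?thesis using assms unfolding cycle_list_def
      by (cases vs) (auto simp: successively_append_iff hd_append split: if_splits)
  qed
  show "orbit f (hd xs) \<subseteq> set xs"
  proof
    fix y assume "y \<in> orbit f (hd xs)"
    then show "y \<in> set xs"
      by induction (use assms in \<open>auto intro: closed simp: cycle_list_def\<close>)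
  qed
  \<comment> \<open>The head of a segment is added by hand: it lies in its own orbit only once the cycle is closed.\<close>
  have reach: "set ys \<subseteq> insert (hd ys) (orbit f (hd ys)) \<and> last ys \<in> insert (hd ys) (orbit f (hd ys))"
    if "ys \<noteq> []" "successively (\<lambda>a b. f a = b) ys" for ys
    using that
  proof (induction ys rule: rev_induct)
    case (snoc z ys)
    show ?case
    proof (cases "ys = []")
      case False
      then have "f (last ys) = z" using snoc.prems by (auto simp: successively_append_iff)
      moreover have "last ys \<in> insert (hd ys) (orbit f (hd ys))" "set ys \<subseteq> insert (hd ys) (orbit f (hd ys))"
        using snoc False by (auto simp: successively_append_iff)
      ultimately show ?thesis using False by (auto intro: orbit.intros)
    qed auto
  qed auto
  have "last xs \<in> insert (hd xs) (orbit f (hd xs))" "set xs \<subseteq> insert (hd xs) (orbit f (hd xs))"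
    using reach[of xs] assms by (auto simp: cycle_list_def)
  moreover have "hd xs \<in> orbit f (hd xs)"
    using calculation(1) assms unfolding cycle_list_def by (metis insertE orbit.intros)
  ultimately show "set xs \<subseteq> orbit f (hd xs)" by auto
qed

lemma cyclic_on_cycle_list:
  assumes "cycle_list f xs"
  shows "cyclic_on f (set xs)"
  using orbit_cycle_list[OF assms] assms
  by (intro cyclic_on_singleI[of "hd xs"]) (auto simp: cycle_list_def)

lemma cycle_list_exists:
  assumes "cyclic_on f S" and "s \<in> S"
  obtains xs where "cycle_list f (s # xs)" and "set (s # xs) = S"
proof -
  have orb: "orbit f s = S" using assms by (rule orbit_cyclic_eq3)
  then have self: "s \<in> orbit f s" using assms by simp
  define n where "n = funpow_dist f (f s) s"
  define xs where "xs = map (\<lambda>i. (f ^^ i) s) [0..<Suc n]"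
  have set: "set xs = S"
    using orbit_conv_funpow_dist1[OF self] orb by (simp add: xs_def n_def del: upt_Suc)
  have "distinct xs"
    using inj_on_funpow_dist1[OF self] by (simp add: xs_def distinct_map n_def del: upt_Suc)
  moreover have "successively (\<lambda>a b. f a = b) xs"
    by (auto simp: xs_def successively_conv_nth simp del: upt_Suc)
  moreover have "xs = s # tl xs"
    by (simp add: xs_def upt_conv_Cons del: upt_Suc)
  moreover have "last xs = (f ^^ n) s" by (simp add: xs_def)
  moreover have "f ((f ^^ n) s) = s"
    using funpow_dist1_prop[OF self] by (simp add: n_def)
  ultimately have "cycle_list f (s # tl xs)"
    unfolding cycle_list_def by (metis list.distinct(1) list.sel(1))
  then show thesis using that set \<open>xs = s # tl xs\<close> by metis
qed

lemma successively_graph_cong: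
  assumes "\<And>y. y \<in> set (butlast xs) \<Longrightarrow> f y = g y"
  shows "successively (\<lambda>a b. f a = b) xs \<longleftrightarrow> successively (\<lambda>a b. g a = b) xs"
proof -
  have "f (xs ! i) = g (xs ! i)" if "Suc i < length xs" for i
    using assms[of "xs ! i"] that by (metis Suc_lessE diff_Suc_1 in_set_conv_nth length_butlast nth_butlast)
  then show ?thesis by (auto simp: successively_conv_nth)
qed

section \<open>Counting by deleting one element\<close>

text \<open>
Multiplying by \<open>transpose x c\<close> on the left inserts the fixed point \<open>x\<close> of \<open>g\<close> into the cycle of \<open>c\<close>,
just before \<open>c\<close>; every cycle on \<open>S\<close> arises from one on \<open>S - {x}\<close> in this way.
\<close>

lemma cyclic_on_insert_transpose:
  assumes "g x = x" and "x \<in> S" and "c \<in> S" and "c \<noteq> x"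
  shows "cyclic_on (transpose x c \<circ> g) S \<longleftrightarrow> cyclic_on g (S - {x})"
proof
  let ?f = "transpose x c \<circ> g"
  assume "cyclic_on ?f S"
  then obtain xs where cyc: "cycle_list ?f (x # xs)" and S: "set (x # xs) = S"
    using \<open>x \<in> S\<close> by (rule cycle_list_exists)
  then obtain ys where xs: "xs = c # ys"
    using assms by (cases xs) (auto simp: cycle_list_def)
  have inv: "g y = transpose x c (?f y)" for y by simp
  have "cycle_list g xs"
    unfolding cycle_list_def
  proof (intro conjI)
    have dist: "distinct (x # c # ys)" using cyc xs by (auto simp: cycle_list_def)
    show "successively (\<lambda>a b. g a = b) xs"
      unfolding successively_conv_nth
    proof (intro allI impI)
      fix i assume i: "Suc i < length xs"
      have "?f (xs ! i) = xs ! Suc i"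
        using cyc i by (auto simp: cycle_list_def successively_Cons successively_conv_nth)
      moreover have "xs ! Suc i \<in> set ys"
        using i xs by auto
      then have "xs ! Suc i \<noteq> x" "xs ! Suc i \<noteq> c" using dist by auto
      ultimately show "g (xs ! i) = xs ! Suc i"
        by (metis inv transpose_apply_other)
    qed
    show "g (last xs) = hd xs"
      using cyc xs inv[of "last xs"] by (auto simp: cycle_list_def simp del: comp_apply)
  qed (use cyc xs in \<open>auto simp: cycle_list_def\<close>)
  then show "cyclic_on g (S - {x})"
    using cyclic_on_cycle_list[of g xs] S cyc by (auto simp: cycle_list_def)
next
  let ?f = "transpose x c \<circ> g"
  assume "cyclic_on g (S - {x})"
  then obtain xs where cyc: "cycle_list g (c # xs)" and S: "set (c # xs) = S - {x}"
    using assms by (metis cycle_list_exists insertE insert_Diff)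
  have dist: "distinct (x # c # xs)" using cyc S by (auto simp: cycle_list_def)
  have "successively (\<lambda>a b. ?f a = b) (c # xs)"
    unfolding successively_conv_nth
  proof (intro allI impI)
    fix i assume i: "Suc i < length (c # xs)"
    have "g ((c # xs) ! i) = (c # xs) ! Suc i"
      using cyc i by (auto simp: cycle_list_def successively_conv_nth)
    moreover have "(c # xs) ! Suc i \<in> set xs" using i by auto
    then have "(c # xs) ! Suc i \<noteq> x" "(c # xs) ! Suc i \<noteq> c" using dist by auto
    ultimately show "?f ((c # xs) ! i) = (c # xs) ! Suc i" by simp
  qed
  then have "cycle_list ?f (x # c # xs)"
    using cyc dist assms by (auto simp: cycle_list_def)
  moreover have "set (x # c # xs) = S" using S \<open>x \<in> S\<close> by auto
  ultimately show "cyclic_on ?f S" using cyclic_on_cycle_list by metis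
qed

definition cyclic_count :: "('a \<Rightarrow> 'a) \<Rightarrow> 'a set \<Rightarrow> nat" where
  "cyclic_count D S = card {\<theta> \<in> cyclic_orders S. cyclic_on (D \<circ> \<theta>) S}"

lemma cyclic_on_no_fixed_point:
  assumes "cyclic_on f S" and "x \<in> S" and "f x = x"
  shows "S = {x}"
  using assms by (metis orbit_cyclic_eq3 orbit_eq_singleton_iff)

text \<open>
Let \<open>\<theta> x = b\<close>. Deleting \<open>x\<close> from \<open>\<theta>\<close> gives \<open>\<theta>' = transpose x b \<circ> \<theta>\<close>, and deleting it from
\<open>D \<circ> \<theta>\<close>, which maps \<open>x\<close> to \<open>D b\<close>, gives \<open>transpose x (D b) \<circ> D \<circ> \<theta>\<close>. The second is the
product of a new permutation \<open>D'\<close> with \<open>\<theta>'\<close>, where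
\<open>D' = transpose x (D b) \<circ> D \<circ> transpose x b\<close>; as \<open>D p = x\<close>, moving the left transposition through
\<open>D\<close> turns it into \<open>transpose p b\<close>. Both deletions can be undone, so the map from \<open>\<theta>\<close> to \<open>\<theta>'\<close> is
a bijection of the sets that are counted.
\<close>

lemma cyclic_count_fiber:
  assumes "x \<in> S" and "D permutes S" and "D p = x" and b: "b \<in> S - {x, p}"
  shows "card {\<theta> \<in> cyclic_orders S. \<theta> x = b \<and> cyclic_on (D \<circ> \<theta>) S} =
    cyclic_count (D \<circ> transpose p b \<circ> transpose x b) (S - {x})"
proof -
  let ?D = "D \<circ> transpose p b \<circ> transpose x b"
  have bS: "b \<in> S" "b \<noteq> x" "b \<noteq> p" using b by auto
  have "inj D" using assms(2) by (rule permutes_inj)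
  have Db: "D b \<in> S" "D b \<noteq> x"
    using bS assms by (auto simp: permutes_in_image dest: permutes_inj injD)
  have Dx: "?D x = x" using bS assms by simp
  have conj: "D \<circ> transpose x b = transpose x (D b) \<circ> ?D"
  proof
    fix y
    have "D (transpose p b z) = transpose (D p) (D b) (D z)" for z
      using \<open>inj D\<close> by (simp add: Transposition.transpose_def inj_eq)
    then show "(D \<circ> transpose x b) y = (transpose x (D b) \<circ> ?D) y"
      using assms(3) by simp
  qed
  have step: "transpose x b \<circ> \<theta> \<in> cyclic_orders S \<and> cyclic_on (D \<circ> (transpose x b \<circ> \<theta>)) S \<longleftrightarrow>
      \<theta> \<in> cyclic_orders (S - {x}) \<and> cyclic_on (?D \<circ> \<theta>) (S - {x})"
    if "\<theta> x = x" for \<theta>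
  proof -
    have "transpose x b \<circ> \<theta> permutes S \<longleftrightarrow> \<theta> permutes S - {x}"
    proof
      assume "transpose x b \<circ> \<theta> permutes S"
      from permutes_compose[OF this permutes_swap_id[OF assms(1) bS(1)]]
      have "\<theta> permutes S" by (simp flip: comp_assoc)
      then show "\<theta> permutes S - {x}"
        by (rule permutes_superset) (use that in auto)
    next
      assume "\<theta> permutes S - {x}"
      then have "\<theta> permutes S" by (rule permutes_subset) auto
      then show "transpose x b \<circ> \<theta> permutes S"
        using assms(1) bS by (intro permutes_compose permutes_swap_id)
    qed
    moreover have "cyclic_on (transpose x b \<circ> \<theta>) S \<longleftrightarrow> cyclic_on \<theta> (S - {x})"
      using cyclic_on_insert_transpose[of \<theta> x S b] that bS assms(1) by simp
    moreover have "cyclic_on (D \<circ> (transpose x b \<circ> \<theta>)) S \<longleftrightarrow> cyclic_on (?D \<circ> \<theta>) (S - {x})"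
    proof -
      have "D \<circ> (transpose x b \<circ> \<theta>) = (D \<circ> transpose x b) \<circ> \<theta>"
        by (simp only: comp_assoc)
      also have "\<dots> = transpose x (D b) \<circ> (?D \<circ> \<theta>)"
        unfolding conj by (simp only: comp_assoc)
      finally have "D \<circ> (transpose x b \<circ> \<theta>) = transpose x (D b) \<circ> (?D \<circ> \<theta>)" .
      then show ?thesis
        using cyclic_on_insert_transpose[of "?D \<circ> \<theta>" x S "D b"] that Dx Db assms(1) by simp
    qed
    ultimately show ?thesis by (auto simp: cyclic_orders_def)
  qed
  have "bij_betw (\<lambda>\<theta>. transpose x b \<circ> \<theta>)
     {\<theta> \<in> cyclic_orders (S - {x}). cyclic_on (?D \<circ> \<theta>) (S - {x})}
     {\<theta> \<in> cyclic_orders S. \<theta> x = b \<and> cyclic_on (D \<circ> \<theta>) S}"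
  proof (rule bij_betw_byWitness[where f' = "\<lambda>\<theta>. transpose x b \<circ> \<theta>"])
    show "(\<lambda>\<theta>. transpose x b \<circ> \<theta>) ` {\<theta> \<in> cyclic_orders (S - {x}). cyclic_on (?D \<circ> \<theta>) (S - {x})}
      \<subseteq> {\<theta> \<in> cyclic_orders S. \<theta> x = b \<and> cyclic_on (D \<circ> \<theta>) S}"
    proof safe
      fix \<theta> assume "\<theta> \<in> cyclic_orders (S - {x})" "cyclic_on (?D \<circ> \<theta>) (S - {x})"
      moreover from this have "\<theta> x = x" by (auto simp: cyclic_orders_def permutes_def)
      ultimately show "transpose x b \<circ> \<theta> \<in> cyclic_orders S"
        "(transpose x b \<circ> \<theta>) x = b" "cyclic_on (D \<circ> (transpose x b \<circ> \<theta>)) S"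
        using step by auto
    qed
    show "(\<lambda>\<theta>. transpose x b \<circ> \<theta>) ` {\<theta> \<in> cyclic_orders S. \<theta> x = b \<and> cyclic_on (D \<circ> \<theta>) S}
      \<subseteq> {\<theta> \<in> cyclic_orders (S - {x}). cyclic_on (?D \<circ> \<theta>) (S - {x})}"
    proof (rule image_subsetI)
      fix \<theta> assume \<theta>: "\<theta> \<in> {\<theta> \<in> cyclic_orders S. \<theta> x = b \<and> cyclic_on (D \<circ> \<theta>) S}"
      then have "(transpose x b \<circ> \<theta>) x = x" by simp
      moreover have "transpose x b \<circ> (transpose x b \<circ> \<theta>) = \<theta>" by (simp flip: comp_assoc)
      ultimately show "transpose x b \<circ> \<theta> \<in> {\<theta> \<in> cyclic_orders (S - {x}). cyclic_on (?D \<circ> \<theta>) (S - {x})}"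
        using step[of "transpose x b \<circ> \<theta>"] \<theta> by auto
    qed
  qed (auto simp flip: comp_assoc)
  then show ?thesis unfolding cyclic_count_def by (simp add: bij_betw_same_card)
qed

text \<open>
The values \<open>b = x\<close> and \<open>b = p\<close> do not occur: they would make \<open>x\<close> a fixed point of \<open>\<theta>\<close> or of
\<open>D \<circ> \<theta>\<close>.
\<close>

lemma cyclic_count_rec:
  assumes "finite S" and "x \<in> S" and "S \<noteq> {x}" and "D permutes S" and "D p = x"
  shows "cyclic_count D S =
    (\<Sum>b\<in>S - {x, p}. cyclic_count (D \<circ> transpose p b \<circ> transpose x b) (S - {x}))"
proof -
  let ?F = "\<lambda>b. {\<theta> \<in> cyclic_orders S. \<theta> x = b \<and> cyclic_on (D \<circ> \<theta>) S}"
  have fin: "finite (cyclic_orders S)"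
    using finite_permutations[OF assms(1)] by (rule rev_finite_subset) (auto simp: cyclic_orders_def)
  have "{\<theta> \<in> cyclic_orders S. cyclic_on (D \<circ> \<theta>) S} = (\<Union>b\<in>S - {x, p}. ?F b)"
  proof (intro equalityI subsetI)
    fix \<theta> assume \<theta>: "\<theta> \<in> {\<theta> \<in> cyclic_orders S. cyclic_on (D \<circ> \<theta>) S}"
    have "\<theta> x \<in> S" using \<theta> assms(2) by (auto simp: cyclic_orders_def permutes_in_image)
    moreover have "\<theta> x \<noteq> x"
      using \<theta> assms cyclic_on_no_fixed_point[of \<theta> S x] by (auto simp: cyclic_orders_def)
    moreover have "\<theta> x \<noteq> p"
      using \<theta> assms cyclic_on_no_fixed_point[of "D \<circ> \<theta>" S x] by auto
    ultimately show "\<theta> \<in> (\<Union>b\<in>S - {x, p}. ?F b)" using \<theta> by auto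
  qed auto
  also have "card \<dots> = (\<Sum>b\<in>S - {x, p}. card (?F b))"
    using assms(1) fin by (intro card_UN_disjoint) auto
  also have "\<dots> = (\<Sum>b\<in>S - {x, p}. cyclic_count (D \<circ> transpose p b \<circ> transpose x b) (S - {x}))"
    using assms by (intro sum.cong refl cyclic_count_fiber) auto
  finally show ?thesis by (simp add: cyclic_count_def)
qed

section \<open>Decompositions into cycles, and what a deletion does to them\<close>

text \<open>
The cycles form a set of lists, with fixed points as lists of length 1, so that one cycle can be
taken out and replaced by others without any renumbering.
\<close>

definition cycle_lists :: "('a \<Rightarrow> 'a) \<Rightarrow> 'a set \<Rightarrow> 'a list set \<Rightarrow> bool" where
  "cycle_lists D S C \<longleftrightarrow> finite C \<and> (\<forall>xs\<in>C. cycle_list D xs) \<and>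
     (\<forall>xs\<in>C. \<forall>ys\<in>C. xs \<noteq> ys \<longrightarrow> set xs \<inter> set ys = {}) \<and> (\<Union>xs\<in>C. set xs) = S"

lemma cycle_lists_insert:
  assumes "xs \<notin> C"
  shows "cycle_lists D S (insert xs C) \<longleftrightarrow>
    cycle_list D xs \<and> set xs \<subseteq> S \<and> cycle_lists D (S - set xs) C"
  using assms unfolding cycle_lists_def by auto blast+

lemma cycle_lists_cong:
  assumes "\<And>y. y \<in> S \<Longrightarrow> D y = D' y"
  shows "cycle_lists D S C \<longleftrightarrow> cycle_lists D' S C"
proof -
  have "cycle_list D xs \<longleftrightarrow> cycle_list D' xs" if "(\<Union>xs\<in>C. set xs) = S" "xs \<in> C" for xs
    using that assms by (intro cycle_list_cong) auto
  then show ?thesis unfolding cycle_lists_def by auto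
qed

lemma cycle_lists_notin:
  assumes "cycle_lists D S C" and "set xs \<inter> S = {}"
  shows "xs \<notin> C"
proof
  assume "xs \<in> C"
  then have "xs \<noteq> []" "set xs \<subseteq> S"
    using assms(1) by (auto simp: cycle_lists_def cycle_list_def)
  then show False using assms(2) by (cases xs) auto
qed

lemma cycle_lists_exists:
  assumes "finite S" and "D permutes S"
  obtains C where "cycle_lists D S C"
proof -
  have "\<exists>xs. cycle_list D xs \<and> set xs = orb" if "orb \<in> orbit D ` S" for orb
  proof -
    have "cyclic_on D orb" using that cyclic_on_orbit[OF assms(2,1)] by auto
    then show ?thesis by (metis cycle_list_exists cyclic_on_def)
  qed
  then obtain L where L: "\<And>orb. orb \<in> orbit D ` S \<Longrightarrow> cycle_list D (L orb) \<and> set (L orb) = orb"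
    by metis
  have perm: "permutation D" using assms permutation_permutes by blast
  have "cycle_lists D S (L ` orbit D ` S)"
    unfolding cycle_lists_def
  proof (intro conjI ballI impI)
    fix xs ys assume "xs \<in> L ` orbit D ` S" "ys \<in> L ` orbit D ` S" "xs \<noteq> ys"
    then obtain x y where xy: "xs = L (orbit D x)" "ys = L (orbit D y)" "x \<in> S" "y \<in> S"
      by blast
    then have ne: "orbit D x \<noteq> orbit D y" using \<open>xs \<noteq> ys\<close> by auto
    have "orbit D x = orbit D y" if "z \<in> orbit D x" "z \<in> orbit D y" for z
      using cyclic_on_orbit'[OF perm] that by (metis orbit_cyclic_eq3)
    then show "set xs \<inter> set ys = {}" using L xy ne by auto
  next
    show "(\<Union>xs\<in>L ` orbit D ` S. set xs) = S"
      using L permutes_orbit_subset[OF assms(2)] permutation_self_in_orbit[OF perm] by auto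
  qed (use L assms(1) in auto)
  then show thesis by (rule that)
qed

lemma orbits_cycle_lists:
  assumes "cycle_lists D S C"
  shows "orbit D ` S = set ` C" and "inj_on set C"
proof -
  have orb: "orbit D y = set xs" if "xs \<in> C" "y \<in> set xs" for xs y
    using assms that cyclic_on_cycle_list orbit_cyclic_eq3 by (metis cycle_lists_def)
  have S: "S = (\<Union>xs\<in>C. set xs)" and ne: "\<And>xs. xs \<in> C \<Longrightarrow> xs \<noteq> []"
    using assms by (auto simp: cycle_lists_def cycle_list_def)
  show "orbit D ` S = set ` C"
  proof
    show "orbit D ` S \<subseteq> set ` C" using orb unfolding S by auto
    show "set ` C \<subseteq> orbit D ` S"
    proof
      fix A assume "A \<in> set ` C"
      then obtain xs where xs: "xs \<in> C" "A = set xs" by blast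
      then have "hd xs \<in> S" "A = orbit D (hd xs)" using orb ne unfolding S by force+
      then show "A \<in> orbit D ` S" by blast
    qed
  qed
  show "inj_on set C"
  proof
    fix xs ys assume "xs \<in> C" "ys \<in> C" "set xs = set ys"
    then show "xs = ys"
      using assms ne unfolding cycle_lists_def by (metis Int_absorb set_empty)
  qed
qed

lemma card_fixed_points_cycle_lists:
  assumes "cycle_lists D S C"
  shows "card {A \<in> orbit D ` S. card A = n} = card {xs \<in> C. length xs = n}"
proof -
  have "card (set xs) = length xs" if "xs \<in> C" for xs
    using assms that by (simp add: cycle_lists_def cycle_list_def distinct_card)
  then have "{A \<in> orbit D ` S. card A = n} = set ` {xs \<in> C. length xs = n}"
    unfolding orbits_cycle_lists(1)[OF assms] by auto
  then show ?thesis
    using orbits_cycle_lists(2)[OF assms] by (simp add: card_image inj_on_subset)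
qed

text \<open>
The permutation \<open>D'\<close> fixes \<open>x\<close>, sends \<open>b\<close> to \<open>D x\<close> and \<open>last vs\<close> to \<open>D b\<close>, and agrees with \<open>D\<close>
elsewhere. If \<open>b\<close> lies on the cycle of \<open>x\<close>, the effect is to close up the part from \<open>D x\<close> to \<open>b\<close> and the part from
\<open>D b\<close> to \<open>last vs\<close> separately.
\<close>

lemma cycle_lists_split:
  assumes "cycle_lists D S (insert (x # us @ b # vs) R)" and "x # us @ b # vs \<notin> R" and "vs \<noteq> []"
  defines "D' \<equiv> D \<circ> transpose (last vs) b \<circ> transpose x b"
  shows "cycle_lists D' (S - {x}) (insert (us @ [b]) (insert vs R))"
    and "us @ [b] \<notin> insert vs R" and "vs \<notin> R"
proof -
  define T where "T = S - set (x # us @ b # vs)"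
  have cyc: "cycle_list D (x # us @ b # vs)" and sub: "set (x # us @ b # vs) \<subseteq> S"
    and R: "cycle_lists D T R"
    using assms(1,2) by (simp_all add: cycle_lists_insert T_def)
  have dist: "distinct (x # us @ b # vs)" using cyc by (simp add: cycle_list_def)
  obtain ws p where vs: "vs = ws @ [p]" using assms(3) rev_exhaust by blast
  have D': "D' y = D y" if "y \<notin> {x, b, p}" for y
    using that by (simp add: D'_def vs)
  have D'b: "D' b = D x" and D'p: "D' p = D b"
    using dist by (auto simp: D'_def vs Transposition.transpose_def)
  have "cycle_lists D' T R"
    using R dist by (subst cycle_lists_cong[of _ _ D]) (auto simp: T_def vs intro: D')
  moreover have "cycle_list D' vs"
  proof -
    have "successively (\<lambda>a b. D' a = b) vs \<longleftrightarrow> successively (\<lambda>a b. D a = b) vs"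
      using dist by (intro successively_graph_cong D') (auto simp: vs)
    then show ?thesis
      using cyc D'p by (auto simp: cycle_list_def vs successively_append_iff successively_Cons hd_append)
  qed
  moreover have "cycle_list D' (us @ [b])"
  proof -
    have "successively (\<lambda>a b. D' a = b) (us @ [b]) \<longleftrightarrow> successively (\<lambda>a b. D a = b) (us @ [b])"
      using dist by (intro successively_graph_cong D') (auto simp: vs)
    moreover have "D x = hd (us @ [b])"
      using cyc by (auto simp: cycle_list_def successively_Cons hd_append)
    ultimately show ?thesis
      using cyc D'b by (auto simp: cycle_list_def successively_append_iff successively_Cons)
  qed
  moreover show "us @ [b] \<notin> insert vs R" "vs \<notin> R"
    using dist assms(3) cycle_lists_notin[OF R, of "us @ [b]"] cycle_lists_notin[OF R, of vs]
    by (auto simp: T_def)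
  moreover have "S - {x} - set (us @ [b]) - set vs = T" by (auto simp: T_def)
  moreover have "set (us @ [b]) \<subseteq> S - {x}" "set vs \<subseteq> S - {x} - set (us @ [b])"
    using dist sub by auto
  ultimately show "cycle_lists D' (S - {x}) (insert (us @ [b]) (insert vs R))"
    by (simp add: cycle_lists_insert)
qed

text \<open>
If \<open>b\<close> lies on another cycle, the same two changed values open the cycle of \<open>x\<close>, without \<open>x\<close>, at
its end and insert there the other cycle, traversed from \<open>D b\<close> to \<open>b\<close>.
\<close>

lemma cycle_lists_merge:
  assumes "cycle_lists D S (insert (x # ys) (insert (us @ b # vs) R))"
    and "x # ys \<notin> insert (us @ b # vs) R" and "us @ b # vs \<notin> R" and "ys \<noteq> []"
  defines "D' \<equiv> D \<circ> transpose (last ys) b \<circ> transpose x b"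
  shows "cycle_lists D' (S - {x}) (insert (ys @ vs @ us @ [b]) R)"
    and "ys @ vs @ us @ [b] \<notin> R"
proof -
  define T where "T = S - set (x # ys) - set (us @ b # vs)"
  have cyc: "cycle_list D (x # ys)" "cycle_list D (us @ b # vs)"
    and sub: "set (x # ys) \<subseteq> S" "set (us @ b # vs) \<subseteq> S - set (x # ys)"
    and R: "cycle_lists D T R"
    using assms(1-3) by (simp_all add: cycle_lists_insert T_def)
  have dist: "distinct (x # ys @ us @ b # vs)" using cyc sub by (auto simp: cycle_list_def)
  obtain ws p where ys: "ys = ws @ [p]" using assms(4) rev_exhaust by blast
  then have p_last: "last ys = p" by simp
  have D': "D' y = D y" if "y \<notin> {x, b, p}" for y
    using that by (simp add: D'_def ys)
  have D'b: "D' b = D x" and D'p: "D' p = D b"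
    using dist by (auto simp: D'_def ys Transposition.transpose_def)
  have "cycle_lists D' T R"
    using R by (subst cycle_lists_cong[of _ _ D]) (auto simp: T_def ys intro: D')
  moreover have "cycle_list D' (ys @ vs @ us @ [b])"
  proof -
    have 1: "successively (\<lambda>a b. D' a = b) ys \<longleftrightarrow> successively (\<lambda>a b. D a = b) ys"
      using dist by (intro successively_graph_cong D') (auto simp: ys)
    have 2: "successively (\<lambda>a b. D' a = b) (vs @ us @ [b]) \<longleftrightarrow> successively (\<lambda>a b. D a = b) (vs @ us @ [b])"
      using dist by (intro successively_graph_cong D') (auto simp: ys butlast_append)
    have 3: "successively (\<lambda>a b. D a = b) (vs @ us @ [b])"
      using cyc(2) by (auto simp: cycle_list_def successively_append_iff successively_Cons hd_append split: if_splits)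
    have 4: "D b = hd (vs @ us @ [b])"
      using cyc(2) by (auto simp: cycle_list_def successively_append_iff successively_Cons hd_append split: if_splits)
    have 5: "D x = hd ys" "successively (\<lambda>a b. D a = b) ys"
      using cyc(1) assms(4) by (auto simp: cycle_list_def successively_Cons)
    have "successively (\<lambda>a b. D' a = b) (ys @ vs @ us @ [b])"
      using 1 2 3 4 5 D'p p_last by (subst successively_append_iff) simp
    then show ?thesis
      using dist D'b 5 by (auto simp: cycle_list_def ys hd_append)
  qed
  moreover show "ys @ vs @ us @ [b] \<notin> R"
    using cycle_lists_notin[OF R, of "ys @ vs @ us @ [b]"] by (auto simp: T_def)
  moreover have "S - {x} - set (ys @ vs @ us @ [b]) = T" by (auto simp: T_def)
  moreover have "set (ys @ vs @ us @ [b]) \<subseteq> S - {x}"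
    using dist sub by auto
  ultimately show "cycle_lists D' (S - {x}) (insert (ys @ vs @ us @ [b]) R)"
    by (simp add: cycle_lists_insert)
qed

section \<open>The integral formula for the count\<close>

text \<open>
The factor that a cycle of length \<open>n\<close> contributes to the integrand. With \<open>X = (1 + t) / 2\<close> and
\<open>Y = (t - 1) / 2\<close> one has \<open>X - Y = 1\<close>, so it is the complete homogeneous polynomial of degree
\<open>n - 1\<close> in \<open>X\<close> and \<open>Y\<close>. The identities below use \<open>X Y = (t\<^sup>2 - 1) / 4\<close> and \<open>X + Y = t\<close>.
\<close>

definition cyc_poly :: "nat \<Rightarrow> real \<Rightarrow> real" where
  "cyc_poly n t = ((1 + t) / 2) ^ n - ((t - 1) / 2) ^ n"

lemma cyc_poly_1 [simp]: "cyc_poly (Suc 0) t = 1"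
  by (simp add: cyc_poly_def field_simps)

lemma continuous_on_cyc_poly [continuous_intros]:
  "continuous_on A (cyc_poly n)"
  unfolding cyc_poly_def by (intro continuous_intros) auto

lemma cyc_poly_has_derivative:
  "(cyc_poly n has_real_derivative n / 2 * cyc_poly (n - 1) t) (at t)"
proof -
  have "((\<lambda>t. ((1 + t) / 2) ^ n) has_real_derivative n * (1 / 2) * ((1 + t) / 2) ^ (n - 1)) (at t)"
    "((\<lambda>t. ((t - 1) / 2) ^ n) has_real_derivative n * (1 / 2) * ((t - 1) / 2) ^ (n - 1)) (at t)"
    by (auto intro!: derivative_eq_intros)
  from DERIV_diff[OF this] show ?thesis
    by (simp add: cyc_poly_def[abs_def] algebra_simps)
qed

text \<open>
This converts the factor of a merged cycle into factors of the two original cycles. The correction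
contains \<open>cyc_poly (c - 1)\<close>, which up to a constant is the derivative of \<open>cyc_poly c\<close>.
\<close>

lemma cyc_poly_merge:
  assumes "c \<ge> 1"
  shows "cyc_poly (l + c) t =
    cyc_poly (Suc l) t * cyc_poly c t - (t\<^sup>2 - 1) / 4 * cyc_poly l t * cyc_poly (c - 1) t"
proof -
  obtain d where d: "c = Suc d" using assms by (cases c) auto
  define X Y where "X = (1 + t) / 2" and "Y = (t - 1) / 2"
  have XY: "X - Y = 1" "(t\<^sup>2 - 1) / 4 = X * Y"
    by (simp_all add: X_def Y_def field_simps power2_eq_square)
  have "(X ^ (Suc l + d) - Y ^ (Suc l + d)) * (X - Y) =
      (X ^ Suc l - Y ^ Suc l) * (X ^ Suc d - Y ^ Suc d) - X * Y * (X ^ l - Y ^ l) * (X ^ d - Y ^ d)"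
    by (simp add: algebra_simps power_add)
  then show ?thesis
    by (simp add: cyc_poly_def d XY flip: X_def Y_def)
qed

text \<open>
Expanding the products in the sum leaves mixed terms \<open>X\<^sup>j Y\<^bsup>l-j\<^esup>\<close>, which form a geometric sum. The
other terms on the right are those that differentiating
\<open>(t\<^sup>2 - 1) / 2 * cyc_poly l t\<close> produces.
\<close>

lemma cyc_poly_split:
  assumes "l \<ge> 1"
  shows "l * cyc_poly (Suc l) t =
    t * cyc_poly l t + l * ((t\<^sup>2 - 1) / 4) * cyc_poly (l - 1) t
      + (\<Sum>j = 1..<l. cyc_poly j t * cyc_poly (l - j) t)"
proof -
  obtain m where m: "l = Suc m" using assms by (cases l) auto
  define X Y where "X = (1 + t) / 2" and "Y = (t - 1) / 2"
  have X: "X = 1 + Y" and t: "t = X + Y"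
    by (simp_all add: X_def Y_def field_simps)
  have XY: "(t\<^sup>2 - 1) / 4 = X * Y"
    by (simp add: X_def Y_def field_simps power2_eq_square)
  have mixed: "(\<Sum>j = 1..<l. x ^ j * y ^ (l - j)) = x * y * (\<Sum>i<m. y ^ (m - Suc i) * x ^ i)"
    for x y :: real
  proof -
    have "(\<Sum>j = 1..<l. x ^ j * y ^ (l - j)) = (\<Sum>i<m. x ^ Suc i * y ^ (m - i))"
      by (simp only: m One_nat_def sum.atLeast_Suc_lessThan_Suc_shift) (simp add: lessThan_atLeast0)
    also have "\<dots> = (\<Sum>i<m. x * y * (y ^ (m - Suc i) * x ^ i))"
    proof (rule sum.cong[OF refl])
      fix i assume "i \<in> {..<m}"
      then have "m - i = Suc (m - Suc i)" by auto
      then show "x ^ Suc i * y ^ (m - i) = x * y * (y ^ (m - Suc i) * x ^ i)" by simp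
    qed
    finally show ?thesis by (simp add: sum_distrib_left)
  qed
  have "(\<Sum>i<m. Y ^ (m - Suc i) * X ^ i) = X ^ m - Y ^ m"
    "(\<Sum>i<m. X ^ (m - Suc i) * Y ^ i) = X ^ m - Y ^ m"
    using power_diff_sumr2[of X m Y] power_diff_sumr2[of Y m X] by (simp_all add: X)
  then have mixed': "(\<Sum>j = 1..<l. X ^ j * Y ^ (l - j)) = X * Y * (X ^ m - Y ^ m)"
     "(\<Sum>j = 1..<l. Y ^ j * X ^ (l - j)) = X * Y * (X ^ m - Y ^ m)"
    unfolding mixed by simp_all
  have "(\<Sum>j = 1..<l. cyc_poly j t * cyc_poly (l - j) t) =
      (\<Sum>j = 1..<l. (X ^ l + Y ^ l) - X ^ j * Y ^ (l - j) - Y ^ j * X ^ (l - j))"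
    by (intro sum.cong refl)
      (auto simp: cyc_poly_def algebra_simps simp flip: X_def Y_def power_add)
  also have "\<dots> = m * (X ^ l + Y ^ l) - 2 * (X * Y * (X ^ m - Y ^ m))"
    unfolding sum_subtractf mixed' by (simp add: m)
  finally show ?thesis
    by (simp add: cyc_poly_def m XY flip: X_def Y_def) (simp add: t X algebra_simps)
qed

lemma integrable_cyc_poly_prod:
  "(\<lambda>t. cyc_poly m t * (\<Prod>c\<in>R. cyc_poly (f c) t)) integrable_on {a..b}"
  "(\<lambda>t. cyc_poly m t * cyc_poly n t * (\<Prod>c\<in>R. cyc_poly (f c) t)) integrable_on {a..b}"
  "(\<lambda>t. \<Prod>c\<in>R. cyc_poly (f c) t) integrable_on {a..b}"
  by (intro integrable_continuous_real continuous_intros)+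

text \<open>
The recursion of the count, for the integral. Here \<open>Suc l\<close> is the length of the cycle of the deleted
element and \<open>R\<close> indexes the other cycles. By \<open>cyc_poly_split\<close> and \<open>cyc_poly_merge\<close> the difference of
the two integrands is the derivative of \<open>(t\<^sup>2 - 1) / 2\<close> times \<open>cyc_poly l\<close> times the product over
\<open>R\<close>, and this function vanishes at \<open>-1\<close> and at \<open>1\<close>.
\<close>

lemma cyc_poly_integral_rec:
  fixes f :: "'i \<Rightarrow> nat"
  assumes "finite R" and "l \<ge> 1" and "\<And>c. c \<in> R \<Longrightarrow> f c \<ge> 1"
  shows "real (l + (\<Sum>c\<in>R. f c)) *
      integral {-1..1} (\<lambda>t. cyc_poly (Suc l) t * (\<Prod>c\<in>R. cyc_poly (f c) t)) =
    (\<Sum>j = 1..<l. integral {-1..1} (\<lambda>t. cyc_poly j t * cyc_poly (l - j) t * (\<Prod>c\<in>R. cyc_poly (f c) t))) +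
    (\<Sum>c\<in>R. f c * integral {-1..1} (\<lambda>t. cyc_poly (l + f c) t * (\<Prod>d\<in>R - {c}. cyc_poly (f d) t)))"
proof -
  define G where "G = (\<lambda>R t. \<Prod>c\<in>R. cyc_poly (f c) t)"
  define E where "E = (\<lambda>t. real (l + (\<Sum>c\<in>R. f c)) * (cyc_poly (Suc l) t * G R t)
      - ((\<Sum>j = 1..<l. cyc_poly j t * cyc_poly (l - j) t * G R t)
        + (\<Sum>c\<in>R. f c * (cyc_poly (l + f c) t * G (R - {c}) t))))"
  have deriv: "((\<lambda>t. (t\<^sup>2 - 1) / 2 * cyc_poly l t * G R t) has_real_derivative E t) (at t)" for t
  proof -
    define s where "s = (\<Sum>c\<in>R. f c / 2 * cyc_poly (f c - 1) t * G (R - {c}) t)"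
    have G': "(G R has_real_derivative s) (at t)"
      unfolding G_def s_def by (rule has_field_derivative_prod) (rule cyc_poly_has_derivative)
    have "((\<lambda>t. (t\<^sup>2 - 1) / 2 * cyc_poly l t * G R t) has_real_derivative
       t * cyc_poly l t * G R t + (t\<^sup>2 - 1) / 2 * (l / 2 * cyc_poly (l - 1) t) * G R t
       + (t\<^sup>2 - 1) / 2 * cyc_poly l t * s) (at t)"
      by (auto intro!: derivative_eq_intros cyc_poly_has_derivative G' simp: field_simps)
    also have "(t\<^sup>2 - 1) / 2 * cyc_poly l t * s =
       (\<Sum>c\<in>R. f c * ((t\<^sup>2 - 1) / 4 * cyc_poly l t * cyc_poly (f c - 1) t) * G (R - {c}) t)"
      unfolding s_def sum_distrib_left by (intro sum.cong refl) (simp add: field_simps)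
    also have "\<dots> = (\<Sum>c\<in>R. f c * (cyc_poly (Suc l) t * G R t)
        - f c * (cyc_poly (l + f c) t * G (R - {c}) t))"
    proof (rule sum.cong[OF refl])
      fix c assume c: "c \<in> R"
      have "G R t = cyc_poly (f c) t * G (R - {c}) t"
        using c assms(1) by (simp add: G_def prod.remove)
      then show "f c * ((t\<^sup>2 - 1) / 4 * cyc_poly l t * cyc_poly (f c - 1) t) * G (R - {c}) t =
          f c * (cyc_poly (Suc l) t * G R t) - f c * (cyc_poly (l + f c) t * G (R - {c}) t)"
        unfolding cyc_poly_merge[OF assms(3)[OF c], of l t] by (simp add: field_simps)
    qed
    also have "\<dots> = (\<Sum>c\<in>R. f c) * (cyc_poly (Suc l) t * G R t)
        - (\<Sum>c\<in>R. f c * (cyc_poly (l + f c) t * G (R - {c}) t))"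
      by (simp add: sum_subtractf sum_distrib_right)
    also have "t * cyc_poly l t * G R t + (t\<^sup>2 - 1) / 2 * (l / 2 * cyc_poly (l - 1) t) * G R t =
       (l * cyc_poly (Suc l) t - (\<Sum>j = 1..<l. cyc_poly j t * cyc_poly (l - j) t)) * G R t"
      unfolding cyc_poly_split[OF assms(2)] by (simp add: algebra_simps)
    finally show ?thesis
      by (simp add: E_def algebra_simps sum_distrib_left sum_distrib_right)
  qed
  have "((\<lambda>t. (t\<^sup>2 - 1) / 2 * cyc_poly l t * G R t) has_vector_derivative E t) (at t within {-1..1})" for t
    unfolding has_real_derivative_iff_has_vector_derivative[symmetric]
    by (rule has_field_derivative_at_within[OF deriv])
  then have "(E has_integral (1\<^sup>2 - 1) / 2 * cyc_poly l 1 * G R 1 - ((-1)\<^sup>2 - 1) / 2 * cyc_poly l (-1) * G R (-1)) {-1..1}"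
    by (intro fundamental_theorem_of_calculus) auto
  then have "(E has_integral 0) {-1..1}" by simp
  moreover have "(E has_integral
     (real (l + (\<Sum>c\<in>R. f c)) * integral {-1..1} (\<lambda>t. cyc_poly (Suc l) t * G R t)
      - ((\<Sum>j = 1..<l. integral {-1..1} (\<lambda>t. cyc_poly j t * cyc_poly (l - j) t * G R t))
        + (\<Sum>c\<in>R. f c * integral {-1..1} (\<lambda>t. cyc_poly (l + f c) t * G (R - {c}) t))))) {-1..1}"
  proof -
    have 1: "((\<lambda>t. cyc_poly m t * G R' t) has_integral integral {-1..1} (\<lambda>t. cyc_poly m t * G R' t)) {-1..1}"
      for m R'
      unfolding G_def by (rule integrable_integral, rule integrable_cyc_poly_prod)
    have 2: "((\<lambda>t. cyc_poly m t * cyc_poly n t * G R t) has_integral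
        integral {-1..1} (\<lambda>t. cyc_poly m t * cyc_poly n t * G R t)) {-1..1}" for m n
      unfolding G_def by (rule integrable_integral, rule integrable_cyc_poly_prod)
    show ?thesis
      unfolding E_def using assms(1)
      by (intro has_integral_diff[OF has_integral_mult_right[OF 1]
            has_integral_add[OF has_integral_sum[OF _ 2] has_integral_sum[OF _ has_integral_mult_right[OF 1]]]])
        simp_all
  qed
  ultimately have "0 = real (l + (\<Sum>c\<in>R. f c)) * integral {-1..1} (\<lambda>t. cyc_poly (Suc l) t * G R t)
      - ((\<Sum>j = 1..<l. integral {-1..1} (\<lambda>t. cyc_poly j t * cyc_poly (l - j) t * G R t))
        + (\<Sum>c\<in>R. f c * integral {-1..1} (\<lambda>t. cyc_poly (l + f c) t * G (R - {c}) t)))"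
    by (rule has_integral_unique)
  then show ?thesis unfolding G_def by linarith
qed

definition cycle_integral :: "'a list set \<Rightarrow> real" where
  "cycle_integral C = integral {-1..1} (\<lambda>t. \<Prod>xs\<in>C. cyc_poly (length xs) t) / 2"

lemma card_cycle_lists:
  assumes "cycle_lists D S C"
  shows "card S = (\<Sum>xs\<in>C. length xs)" and "finite S"
proof -
  have "card S = (\<Sum>xs\<in>C. card (set xs))"
    using assms unfolding cycle_lists_def by (subst card_UN_disjoint[symmetric]) auto
  also have "\<dots> = (\<Sum>xs\<in>C. length xs)"
    using assms by (intro sum.cong refl distinct_card) (auto simp: cycle_lists_def cycle_list_def)
  finally show "card S = (\<Sum>xs\<in>C. length xs)" .
  show "finite S" using assms by (auto simp: cycle_lists_def)
qed

text \<open>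
Boccara's formula, by induction on \<open>card S\<close>. An arbitrary element \<open>x\<close> that heads one of the lists is
deleted. If \<open>x\<close> is a fixed point of \<open>D\<close>, every choice of \<open>b\<close> leaves \<open>D\<close> unchanged elsewhere.
Otherwise let \<open>x # ys\<close> be its cycle. The elements \<open>b\<close> of \<open>ys\<close> before the last one split it, one for
each pair of lengths \<open>j\<close> and \<open>l - j\<close>; the elements \<open>b\<close> of another cycle \<open>c\<close> all merge it with \<open>c\<close>,
which accounts for the weight \<open>length c\<close> in \<open>cyc_poly_integral_rec\<close>.
\<close>

lemma cyclic_count_eq_cycle_integral:
  assumes "cycle_lists D S C" and "D permutes S" and "S \<noteq> {}"
  shows "real (cyclic_count D S) = fact (card S - 1) * cycle_integral C"
  using assms
proof (induction "card S" arbitrary: D S C rule: less_induct)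
  case less
  note finS = card_cycle_lists(2)[OF less.prems(1)] and cardS = card_cycle_lists(1)[OF less.prems(1)]
  have finC: "finite C" using less.prems(1) by (simp add: cycle_lists_def)
  obtain c where "c \<in> C" "c \<noteq> []"
    using less.prems(1,3) by (force simp: cycle_lists_def cycle_list_def)
  then obtain x ys R where C: "C = insert (x # ys) R" and xR: "x # ys \<notin> R"
    by (metis mk_disjoint_insert neq_Nil_conv)
  have finR: "finite R" using finC C by simp
  have xs: "cycle_list D (x # ys)" "set (x # ys) \<subseteq> S" and R: "cycle_lists D (S - set (x # ys)) R"
    using less.prems(1) xR unfolding C by (simp_all add: cycle_lists_insert)
  have xS: "x \<in> S" using xs by simp
  have Rne: "length c \<ge> 1" if "c \<in> R" for c
    using R that by (cases c) (auto simp: cycle_lists_def cycle_list_def)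
  show ?case
  proof (cases "S = {x}")
    case True
    have "R = {}"
      using R Rne unfolding True by (fastforce simp: cycle_lists_def)
    moreover have "ys = []" using xs True by (cases ys) (auto simp: cycle_list_def)
    moreover have "cyclic_on id {x}" by (simp add: cyclic_on_def orbit_eq_singleton_iff[THEN iffD2])
    then have "{\<theta> \<in> cyclic_orders S. cyclic_on (D \<circ> \<theta>) S} = {id}"
      using less.prems(2) True by (auto simp: cyclic_orders_def permutes_sing)
    ultimately show ?thesis
      by (simp add: cyclic_count_def cycle_integral_def C True)
  next
    case False
    define p where "p = last (x # ys)"
    have Dp: "D p = x" using xs by (simp add: cycle_list_def p_def)
    \<comment> \<open>The natural number with \<open>card S = N + 2\<close>; \<open>card S\<close> is at least 2 here.\<close>
    define N where "N = card S - 2"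
    have cS1: "card S - 1 = Suc N" "card (S - {x}) - 1 = N" "card (S - {x}) < card S" "S - {x} \<noteq> {}"
      using False xS finS card_gt_0_iff[of "S - {x}"] by (auto simp: N_def card_Diff_singleton_if)
    define D' where "D' b = D \<circ> transpose p b \<circ> transpose x b" for b
    have perm': "D' b permutes S - {x}" if "b \<in> S - {x, p}" for b
    proof -
      have "p \<in> S" using Dp xS less.prems(2) by (metis permutes_in_image)
      then have "D' b permutes S" unfolding D'_def using that xS less.prems(2)
        by (intro permutes_compose permutes_swap_id) auto
      moreover have "D' b x = x" using that Dp by (auto simp: D'_def)
      ultimately show ?thesis by (auto intro: permutes_superset[where S = S])
    qed
    have IH: "real (cyclic_count (D' b) (S - {x})) = fact N * cycle_integral C'"
      if "b \<in> S - {x, p}" "cycle_lists (D' b) (S - {x}) C'" for b C'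
      using less.hyps[OF cS1(3) that(2) perm'[OF that(1)] cS1(4)] cS1(2) by simp
    have rec: "real (cyclic_count D S) = (\<Sum>b\<in>S - {x, p}. real (cyclic_count (D' b) (S - {x})))"
      using cyclic_count_rec[OF finS xS False less.prems(2) Dp] by (simp add: D'_def)
    show ?thesis
    proof (cases "ys = []")
      case True
      have "D' b = D" if "b \<in> S - {x, p}" for b
        using that True by (simp add: D'_def p_def comp_assoc)
      moreover have "cycle_lists D (S - {x}) R" using R True by simp
      ultimately have "real (cyclic_count (D' b) (S - {x})) = fact N * cycle_integral R"
        if "b \<in> S - {x, p}" for b
        using that IH by simp
      then have "real (cyclic_count D S) = card (S - {x}) * (fact N * cycle_integral R)"
        using True by (simp add: rec p_def)
      moreover have "card (S - {x}) = Suc N" using cS1(1) xS finS by simp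
      moreover have "cycle_integral C = cycle_integral R"
        using finR xR True by (simp add: C cycle_integral_def)
      ultimately show ?thesis unfolding cS1(1) by simp
    next
      case ysne: False
      define l where "l = length ys"
      define P where "P R t = (\<Prod>c\<in>R. cyc_poly (length c) t)" for R :: "'a list set" and t
      have dist: "distinct (x # ys)" using xs by (simp add: cycle_list_def)
      have p_last: "p = last ys" using ysne by (simp add: p_def)
      then have ys_eq: "ys = butlast ys @ [p]" using ysne by simp
      have S_eq: "S - {x, p} = set (butlast ys) \<union> (\<Union>c\<in>R. set c)"
      proof -
        have "(\<Union>c\<in>R. set c) = S - insert x (set ys)" using R by (simp add: cycle_lists_def)
        moreover have "set ys = insert p (set (butlast ys))" by (subst ys_eq) auto
        moreover have "distinct (butlast ys @ [p])" using dist ys_eq by (metis distinct.simps(2))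
        then have "p \<notin> set (butlast ys)" by simp
        ultimately show ?thesis using xs(2) dist by auto
      qed
      have disj: "set (butlast ys) \<inter> (\<Union>c\<in>R. set c) = {}"
        using R by (auto simp: cycle_lists_def dest: in_set_butlastD)
      have "real (cyclic_count D S) =
          (\<Sum>b\<in>set (butlast ys). real (cyclic_count (D' b) (S - {x})))
        + (\<Sum>c\<in>R. \<Sum>b\<in>set c. real (cyclic_count (D' b) (S - {x})))"
      proof -
        have "(\<Sum>b\<in>(\<Union>c\<in>R. set c). real (cyclic_count (D' b) (S - {x}))) =
            (\<Sum>c\<in>R. \<Sum>b\<in>set c. real (cyclic_count (D' b) (S - {x})))"
          using R by (intro sum.UNION_disjoint) (auto simp: cycle_lists_def)
        then show ?thesis
          unfolding rec S_eq using disj finR by (subst sum.union_disjoint) auto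
      qed
      also have "(\<Sum>b\<in>set (butlast ys). real (cyclic_count (D' b) (S - {x}))) =
          (\<Sum>j = 1..<l. fact N *
            (integral {-1..1} (\<lambda>t. cyc_poly j t * cyc_poly (l - j) t * P R t) / 2))"
      proof -
        have "bij_betw (\<lambda>j. ys ! (j - 1)) {1..<l} (set (butlast ys))"
        proof (rule bij_betw_imageI)
          show "inj_on (\<lambda>j. ys ! (j - 1)) {1..<l}"
            using dist by (auto simp: inj_on_def l_def nth_eq_iff_index_eq)
          have "set (butlast ys) = (\<lambda>i. butlast ys ! i) ` {..<l - 1}"
            by (auto simp: set_conv_nth l_def)
          also have "\<dots> = (\<lambda>i. ys ! i) ` {..<l - 1}"
            by (intro image_cong) (auto simp: nth_butlast l_def)
          also have "{..<l - 1} = (\<lambda>j. j - 1) ` {1..<l}"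
            by (auto simp: image_iff intro!: bexI[of _ "Suc _"])
          finally show "(\<lambda>j. ys ! (j - 1)) ` {1..<l} = set (butlast ys)"
            by (simp add: image_image)
        qed
        then have "(\<Sum>b\<in>set (butlast ys). real (cyclic_count (D' b) (S - {x}))) =
            (\<Sum>j = 1..<l. real (cyclic_count (D' (ys ! (j - 1))) (S - {x})))"
          by (rule sum.reindex_bij_betw[symmetric])
        also have "\<dots> = (\<Sum>j = 1..<l. fact N *
            (integral {-1..1} (\<lambda>t. cyc_poly j t * cyc_poly (l - j) t * P R t) / 2))"
        proof (rule sum.cong[OF refl])
          fix j assume j: "j \<in> {1..<l}"
          define us b vs where "us = take (j - 1) ys" and "b = ys ! (j - 1)" and "vs = drop j ys"
          have ys: "ys = us @ b # vs"
            using j id_take_nth_drop[of "j - 1" ys] by (auto simp: us_def b_def vs_def l_def)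
          have len: "length us = j - 1" "length vs = l - j"
            using j by (auto simp: us_def vs_def l_def)
          then have vsne: "vs \<noteq> []" using j by auto
          have p_vs: "p = last vs" using vsne by (simp add: p_last ys)
          have b: "b \<in> S - {x, p}"
            using dist xs(2) vsne by (auto simp: ys p_vs)
          have "cycle_lists D S (insert (x # us @ b # vs) R)" "x # us @ b # vs \<notin> R"
            using less.prems(1) xR by (simp_all add: C ys)
          from cycle_lists_split[OF this vsne]
          have split: "cycle_lists (D' b) (S - {x}) (insert (us @ [b]) (insert vs R))"
            "us @ [b] \<notin> insert vs R" "vs \<notin> R"
            by (simp_all add: D'_def p_vs)
          have "cycle_integral (insert (us @ [b]) (insert vs R)) =
              integral {-1..1} (\<lambda>t. cyc_poly j t * cyc_poly (l - j) t * P R t) / 2"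
            using split(2,3) finR len j by (simp add: cycle_integral_def P_def mult.assoc)
          then show "real (cyclic_count (D' (ys ! (j - 1))) (S - {x})) = fact N *
             (integral {-1..1} (\<lambda>t. cyc_poly j t * cyc_poly (l - j) t * P R t) / 2)"
            using IH[OF b split(1)] by (simp add: b_def)
        qed
        finally show ?thesis .
      qed
      also have "(\<Sum>c\<in>R. \<Sum>b\<in>set c. real (cyclic_count (D' b) (S - {x}))) =
          (\<Sum>c\<in>R. length c * (fact N *
            (integral {-1..1} (\<lambda>t. cyc_poly (l + length c) t * P (R - {c}) t) / 2)))"
      proof (rule sum.cong[OF refl])
        fix c assume c: "c \<in> R"
        define K where "K = fact N *
            (integral {-1..1} (\<lambda>t. cyc_poly (l + length c) t * P (R - {c}) t) / 2)"
        have each: "real (cyclic_count (D' b) (S - {x})) = K"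
          if bc: "b \<in> set c" for b
        proof -
          obtain us vs where c_eq: "c = us @ b # vs" using bc by (meson split_list)
          have Rc: "insert c (R - {c}) = R" using c by auto
          have b: "b \<in> S - {x, p}" using S_eq bc c by blast
          have "cycle_lists D S (insert (x # ys) (insert (us @ b # vs) (R - {c})))"
            "x # ys \<notin> insert (us @ b # vs) (R - {c})" "us @ b # vs \<notin> R - {c}"
            using less.prems(1) xR Rc by (simp_all add: C flip: c_eq)
          from cycle_lists_merge[OF this ysne]
          have merge: "cycle_lists (D' b) (S - {x}) (insert (ys @ vs @ us @ [b]) (R - {c}))"
            "ys @ vs @ us @ [b] \<notin> R - {c}"
            by (simp_all add: D'_def p_last)
          have "length (ys @ vs @ us @ [b]) = l + length c" by (simp add: l_def c_eq)
          then have "cycle_integral (insert (ys @ vs @ us @ [b]) (R - {c})) =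
              integral {-1..1} (\<lambda>t. cyc_poly (l + length c) t * P (R - {c}) t) / 2"
            unfolding cycle_integral_def P_def using merge(2) finR
            by (subst prod.insert) (auto simp only: finite_Diff)
          then show ?thesis using IH[OF b merge(1)] by (simp add: K_def)
        qed
        have "(\<Sum>b\<in>set c. real (cyclic_count (D' b) (S - {x}))) = (\<Sum>b\<in>set c. K)"
          by (rule sum.cong[OF refl each])
        also have "\<dots> = length c * K"
          using R c by (auto simp: cycle_lists_def cycle_list_def distinct_card)
        finally show "(\<Sum>b\<in>set c. real (cyclic_count (D' b) (S - {x}))) =
            length c * (fact N *
              (integral {-1..1} (\<lambda>t. cyc_poly (l + length c) t * P (R - {c}) t) / 2))"
          unfolding K_def .
      qed
      finally have "real (cyclic_count D S) = fact N / 2 *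
         ((\<Sum>j = 1..<l. integral {-1..1} (\<lambda>t. cyc_poly j t * cyc_poly (l - j) t * P R t)) +
          (\<Sum>c\<in>R. length c * integral {-1..1} (\<lambda>t. cyc_poly (l + length c) t * P (R - {c}) t)))"
        by (simp add: sum_distrib_left sum_divide_distrib distrib_left mult_ac)
      also have "\<dots> = fact N / 2 * (real (l + (\<Sum>c\<in>R. length c)) *
          integral {-1..1} (\<lambda>t. cyc_poly (Suc l) t * P R t))"
        unfolding P_def using ysne Rne
        by (subst cyc_poly_integral_rec[OF finR]) (auto simp: l_def Suc_le_eq)
      also have "l + (\<Sum>c\<in>R. length c) = Suc N"
        using cardS cS1(1) xR finR by (simp add: C l_def)
      also have "integral {-1..1} (\<lambda>t. cyc_poly (Suc l) t * P R t) = 2 * cycle_integral C"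
        using xR finR by (simp add: C cycle_integral_def P_def l_def)
      finally show ?thesis unfolding cS1(1) by simp
    qed
  qed
qed

text \<open>
For \<open>D = id\<close> every cycle is favourable, and all cycles of \<open>id\<close> contribute the factor 1.
\<close>

lemma card_cyclic_orders:
  assumes "finite S" and "S \<noteq> {}"
  shows "card (cyclic_orders S) = fact (card S - 1)"
proof -
  let ?C = "(\<lambda>x. [x]) ` S"
  have "cycle_lists id S ?C"
    using assms(1) by (auto simp: cycle_lists_def cycle_list_def)
  then have "real (cyclic_count id S) = fact (card S - 1) * cycle_integral ?C"
    using assms(2) permutes_id by (intro cyclic_count_eq_cycle_integral)
  moreover have "(\<Prod>xs\<in>?C. cyc_poly (length xs) t) = 1" for t
    by (intro prod.neutral) auto
  then have "cycle_integral ?C = 1" by (simp add: cycle_integral_def)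
  moreover have "cyclic_count id S = card (cyclic_orders S)"
    unfolding cyclic_count_def by (rule arg_cong[where f = card]) (auto simp: cyclic_orders_def)
  ultimately have "real (card (cyclic_orders S)) = real (fact (card S - 1))" by simp
  then show ?thesis by (simp only: of_nat_eq_iff)
qed

lemma cyc_poly_reflect: "cyc_poly n (- t) = (if even n then - 1 else 1) * cyc_poly n t"
proof -
  have eq: "(1 + - t) / 2 = - ((t - 1) / 2)" "(- t - 1) / 2 = - ((1 + t) / 2)"
    by (simp_all add: field_simps)
  show ?thesis
    unfolding cyc_poly_def eq power_minus[of "(t - 1) / 2"] power_minus[of "(1 + t) / 2"] by simp
qed

text \<open>
Each even cycle contributes an odd factor, and each odd cycle an even one.
\<close>

lemma integral_cyc_poly_reflect:
  assumes "finite C"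
  shows "integral {-1..1} (\<lambda>t. \<Prod>c\<in>C. cyc_poly (f c) t) =
    (if even (card {c \<in> C. even (f c)}) then 2 * integral {0..1} (\<lambda>t. \<Prod>c\<in>C. cyc_poly (f c) t) else 0)"
proof -
  define F where "F t = (\<Prod>c\<in>C. cyc_poly (f c) t)" for t
  have "(\<Prod>c\<in>C. if even (f c) then - 1 else 1 :: real) = (- 1) ^ card {c \<in> C. even (f c)}"
    using assms by (simp add: prod.If_cases Int_def)
  then have reflect: "F (- t) = (- 1) ^ card {c \<in> C. even (f c)} * F t" for t
    by (simp add: F_def cyc_poly_reflect prod.distrib)
  have int: "F integrable_on {a..b}" for a b
    unfolding F_def by (intro integrable_continuous_real continuous_intros)
  have "integral {-1..1} F = integral {-1..0} F + integral {0..1} F"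
    using int by (intro Henstock_Kurzweil_Integration.integral_combine[symmetric]) auto
  also have "integral {-1..0} F = integral {0..1} (\<lambda>t. F (- t))"
    using Henstock_Kurzweil_Integration.integral_reflect_real[of 1 0 "\<lambda>t. F (- t)"] by (simp only: minus_minus minus_zero)
  also have "\<dots> = (- 1) ^ card {c \<in> C. even (f c)} * integral {0..1} F"
    by (simp add: reflect)
  finally show ?thesis
    by (auto simp: F_def[abs_def])
qed

section \<open>The lower bound\<close>

text \<open>
Monotonicity of \<open>p\<close>-norms of \<open>(r, y)\<close> between \<open>p = 2\<close> and \<open>p = n\<close>.
\<close>

lemma power_add_le_power_of_pythagorean:
  fixes r y x :: real
  assumes "0 \<le> r" "0 \<le> y" "0 \<le> x" "r\<^sup>2 + y\<^sup>2 = x\<^sup>2" "n \<ge> 2"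
  shows "r ^ n + y ^ n \<le> x ^ n"
  using assms(5)
proof (induction n rule: dec_induct)
  case (step n)
  have "r \<le> x" "y \<le> x"
    using assms(1-4) by (metis le_add_same_cancel1 le_add_same_cancel2 power2_le_imp_le zero_le_power2)+
  then have "r ^ Suc n + y ^ Suc n \<le> x * r ^ n + x * y ^ n"
    using assms by (simp add: add_mono mult_right_mono)
  also have "\<dots> \<le> x * x ^ n"
    using step.IH assms(3) by (metis distrib_left mult_left_mono)
  finally show ?case by simp
qed (use assms in simp)

text \<open>
The numbers \<open>sqrt t\<close>, \<open>(1 - t) / 2\<close> and \<open>(1 + t) / 2\<close> are the sides of a right triangle.
\<close>

lemma cyc_poly_ge_sqrt_power:
  assumes "0 \<le> t" "t \<le> 1" "n \<ge> 2"
  shows "sqrt t ^ n \<le> cyc_poly n t"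
proof -
  have "(sqrt t)\<^sup>2 + ((1 - t) / 2)\<^sup>2 = ((1 + t) / 2)\<^sup>2"
    using assms(1) by (simp add: field_simps power2_eq_square)
  then have "sqrt t ^ n + ((1 - t) / 2) ^ n \<le> ((1 + t) / 2) ^ n"
    using assms by (intro power_add_le_power_of_pythagorean) auto
  moreover have "((t - 1) / 2) ^ n \<le> ((1 - t) / 2) ^ n"
  proof -
    have "((t - 1) / 2) ^ n \<le> \<bar>(t - 1) / 2\<bar> ^ n"
      by (metis abs_ge_self power_abs)
    also have "\<bar>(t - 1) / 2\<bar> = (1 - t) / 2" using assms by simp
    finally show ?thesis .
  qed
  ultimately show ?thesis by (simp add: cyc_poly_def)
qed

lemma prod_cyc_poly_ge_sqrt_power:
  assumes "finite C" and "\<And>c. c \<in> C \<Longrightarrow> f c \<ge> 1" and "0 \<le> t" "t \<le> 1"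
  shows "sqrt t ^ (\<Sum>c | c \<in> C \<and> f c \<ge> 2. f c) \<le> (\<Prod>c\<in>C. cyc_poly (f c) t)"
proof -
  have "sqrt t ^ (\<Sum>c | c \<in> C \<and> f c \<ge> 2. f c) = (\<Prod>c | c \<in> C \<and> f c \<ge> 2. sqrt t ^ f c)"
    by (simp add: power_sum)
  also have "\<dots> \<le> (\<Prod>c | c \<in> C \<and> f c \<ge> 2. cyc_poly (f c) t)"
    using assms by (intro prod_mono) (auto intro: cyc_poly_ge_sqrt_power)
  also have "\<dots> = (\<Prod>c\<in>C. cyc_poly (f c) t)"
  proof (rule prod.mono_neutral_left)
    show "\<forall>c\<in>C - {c \<in> C. 2 \<le> f c}. cyc_poly (f c) t = 1"
    proof
      fix c assume "c \<in> C - {c \<in> C. 2 \<le> f c}"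
      then have "f c = Suc 0" using assms(2)[of c] by auto
      then show "cyc_poly (f c) t = 1" by simp
    qed
  qed (use assms in auto)
  finally show ?thesis .
qed

lemma has_integral_sqrt_power:
  "((\<lambda>t. sqrt t ^ m) has_integral 2 / (real m + 2)) {0..1}"
proof -
  have "((\<lambda>t. sqrt t ^ m) has_integral
      2 / (real m + 2) * sqrt 1 ^ (m + 2) - 2 / (real m + 2) * sqrt 0 ^ (m + 2)) {0..1}"
  proof (rule fundamental_theorem_of_calculus_interior)
    fix t :: real assume t: "t \<in> {0<..<1}"
    have "((\<lambda>t. 2 / (real m + 2) * sqrt t ^ (m + 2)) has_real_derivative
        2 / (real m + 2) * (real (m + 2) * (inverse (sqrt t) / 2 * sqrt t ^ (m + 2 - Suc 0)))) (at t)"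
      by (rule DERIV_cmult[OF DERIV_power[OF DERIV_real_sqrt]]) (use t in simp)
    also have "2 / (real m + 2) * (real (m + 2) * (inverse (sqrt t) / 2 * sqrt t ^ (m + 2 - Suc 0))) = sqrt t ^ m"
      using t by (simp add: field_simps)
    finally show "((\<lambda>t. 2 / (real m + 2) * sqrt t ^ (m + 2)) has_vector_derivative sqrt t ^ m) (at t)"
      by (simp add: has_real_derivative_iff_has_vector_derivative)
  qed (auto intro!: continuous_intros)
  then show ?thesis by simp
qed

section \<open>Bounding the integrand from above\<close>

definition pow_sum :: "nat \<Rightarrow> real \<Rightarrow> real" where
  "pow_sum n t = ((1 + t) / 2) ^ n + ((1 - t) / 2) ^ n"

lemma continuous_on_pow_sum [continuous_intros]:
  "continuous_on A (pow_sum n)"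
  unfolding pow_sum_def by (intro continuous_intros) auto

lemma pow_sum_nonneg: "0 \<le> t \<Longrightarrow> t \<le> 1 \<Longrightarrow> 0 \<le> pow_sum n t"
  by (simp add: pow_sum_def)

lemma pow_sum_mult_le:
  assumes "0 \<le> t" "t \<le> 1"
  shows "pow_sum (m + n) t \<le> pow_sum m t * pow_sum n t"
  using assms by (simp add: pow_sum_def power_add algebra_simps)

text \<open>
For small \<open>n\<close> the symmetric function \<open>X\<^sup>n + Y\<^sup>n\<close> of \<open>X = (1 + t) / 2\<close> and \<open>Y = (1 - t) / 2\<close> in terms
of \<open>w = X Y\<close>, using \<open>X + Y = 1\<close>.
\<close>

lemma pow_sum_poly:
  defines "w \<equiv> \<lambda>t. (1 - t\<^sup>2) / 4"
  shows "pow_sum 0 t = 2" "pow_sum (Suc 0) t = 1" "pow_sum 2 t = 1 - 2 * w t" "pow_sum 3 t = 1 - 3 * w t"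
    "pow_sum 4 t = 1 - 4 * w t + 2 * (w t)\<^sup>2" "pow_sum 5 t = 1 - 5 * w t + 5 * (w t)\<^sup>2"
  unfolding pow_sum_def w_def power_divide
  by (simp_all add: field_simps eval_nat_numeral)

lemma cyc_poly_odd: "odd n \<Longrightarrow> cyc_poly n t = pow_sum n t"
proof -
  have "(t - 1) / 2 = - ((1 - t) / 2)" by (simp add: field_simps)
  then show "odd n \<Longrightarrow> cyc_poly n t = pow_sum n t"
    unfolding cyc_poly_def pow_sum_def by (simp only: power_minus[of "(1 - t) / 2"]) simp
qed

lemma cyc_poly_even: "even n \<Longrightarrow> cyc_poly n t = ((1 + t) / 2) ^ n - ((1 - t) / 2) ^ n"
proof -
  have "(t - 1) / 2 = - ((1 - t) / 2)" by (simp add: field_simps)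
  then show "even n \<Longrightarrow> cyc_poly n t = ((1 + t) / 2) ^ n - ((1 - t) / 2) ^ n"
    unfolding cyc_poly_def by (simp only: power_minus[of "(1 - t) / 2"]) simp
qed

lemma cyc_poly_nonneg:
  assumes "0 \<le> t" "t \<le> 1"
  shows "0 \<le> cyc_poly n t"
proof (cases "even n")
  case True
  then show ?thesis using assms by (simp add: cyc_poly_even power_mono divide_right_mono)
qed (use assms in \<open>simp add: cyc_poly_odd pow_sum_nonneg\<close>)

text \<open>
Even cycles are estimated in pairs because \<open>pow_sum 2\<close> is too large to stand for a cycle of length
2: already \<open>pow_sum 2 t * pow_sum 2 t\<close> exceeds \<open>pow_sum 4 t\<close>. A pair has index sum at least 4.
\<close>

lemma cyc_poly_even_mult_le:
  assumes "0 \<le> t" "t \<le> 1" "even m" "even n"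
  shows "cyc_poly m t * cyc_poly n t \<le> pow_sum (m + n) t"
proof -
  have "cyc_poly m t * cyc_poly n t = pow_sum (m + n) t
     - (((1 + t) / 2) ^ m * ((1 - t) / 2) ^ n + ((1 - t) / 2) ^ m * ((1 + t) / 2) ^ n)"
    using assms(3,4) by (simp only: cyc_poly_even pow_sum_def power_add) (simp only: algebra_simps)
  also have "\<dots> \<le> pow_sum (m + n) t"
  proof -
    have "0 \<le> ((1 + t) / 2) ^ m * ((1 - t) / 2) ^ n + ((1 - t) / 2) ^ m * ((1 + t) / 2) ^ n"
      using assms(1,2) by (intro add_nonneg_nonneg mult_nonneg_nonneg zero_le_power) auto
    then show ?thesis by linarith
  qed
  finally show ?thesis .
qed

text \<open>
For \<open>n \<ge> 3\<close> this is \<open>p\<^sub>3\<^sup>u p\<^sub>r\<close> with \<open>n = 3 u + r\<close> and \<open>r\<close> in \<open>{3, 4, 5}\<close>, where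
\<open>p\<^sub>i = pow_sum i\<close>: the integrand for cycles of total length \<open>n\<close>, nearly all of length 3.

The more obvious majorant \<open>p\<^sub>3\<^bsup>n/3\<^esup>\<close> is too large, since its integral exceeds
\<open>2 / (n + 19/29)\<close> for \<open>n = 8\<close>.
\<close>

definition cycle_bound :: "nat \<Rightarrow> real \<Rightarrow> real" where
  "cycle_bound n t =
     (if n = 0 then 1 else pow_sum 3 t ^ ((n - 3) div 3) * pow_sum (3 + n mod 3) t)"

lemma cycle_bound_0 [simp]: "cycle_bound 0 t = 1"
  by (simp add: cycle_bound_def)

lemma cycle_bound_eq:
  assumes "r \<in> {3, 4, 5}"
  shows "cycle_bound (3 * i + r) t = pow_sum 3 t ^ i * pow_sum r t"
proof -
  have "r = 3 \<or> r = 4 \<or> r = 5" using assms by simp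
  then have "(3 * i + r - 3) div 3 = i" "3 + (3 * i + r) mod 3 = r" "3 * i + r \<noteq> 0"
    by presburger+
  then show ?thesis by (simp only: cycle_bound_def if_False)
qed

lemma continuous_on_cycle_bound [continuous_intros]:
  "continuous_on A (cycle_bound n)"
  by (cases "n = 0") (auto simp: cycle_bound_def[abs_def] intro!: continuous_intros)

lemma three_le_decompose:
  fixes n :: nat
  assumes "n \<ge> 3"
  obtains i r where "n = 3 * i + r" "r \<in> {3, 4, 5}"
proof -
  have "n = 3 * (n div 3 - 1) + (3 + n mod 3)" using assms by presburger
  moreover have "3 + n mod 3 \<in> {3, 4, 5}" by (auto; presburger)
  ultimately show thesis using that by blast
qed

lemma cycle_bound_nonneg: "0 \<le> t \<Longrightarrow> t \<le> 1 \<Longrightarrow> 0 \<le> cycle_bound n t"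
  by (simp add: cycle_bound_def pow_sum_nonneg)

lemma pow_sum_le_cycle_bound:
  assumes "0 \<le> t" "t \<le> 1" "n \<ge> 3"
  shows "pow_sum n t \<le> cycle_bound n t"
proof -
  obtain i r where n: "n = 3 * i + r" "r \<in> {3, 4, 5}" using assms(3) by (rule three_le_decompose)
  have "pow_sum (3 * i + r) t \<le> pow_sum 3 t ^ i * pow_sum r t"
  proof (induction i)
    case (Suc i)
    have "pow_sum (3 * Suc i + r) t \<le> pow_sum 3 t * pow_sum (3 * i + r) t"
      using pow_sum_mult_le[OF assms(1,2), of 3 "3 * i + r"] by (simp add: add.assoc)
    also have "\<dots> \<le> pow_sum 3 t * (pow_sum 3 t ^ i * pow_sum r t)"
      using Suc pow_sum_nonneg[OF assms(1,2)] by (intro mult_left_mono)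
    finally show ?case by (simp add: mult.assoc)
  qed simp
  then show ?thesis by (simp add: n(1) cycle_bound_eq[OF n(2)])
qed

text \<open>
Splitting off the powers of \<open>p\<^sub>3\<close> reduces this to products \<open>p\<^sub>r p\<^sub>s\<close> with \<open>r\<close> and \<open>s\<close> in
\<open>{3, 4, 5}\<close>. The three cases that are not equalities become polynomial inequalities in
\<open>w = (1 - t\<^sup>2) / 4\<close>, to be checked for \<open>w\<close> between 0 and 1/4.
\<close>

lemma cycle_bound_mult_le:
  assumes t: "0 \<le> t" "t \<le> 1" and "m = 0 \<or> m \<ge> 3" "n = 0 \<or> n \<ge> 3"
  shows "cycle_bound m t * cycle_bound n t \<le> cycle_bound (m + n) t"
proof (cases "m = 0 \<or> n = 0")
  case False
  then have "m \<ge> 3" "n \<ge> 3" using assms(3,4) by auto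
  then obtain i r j s where m: "m = 3 * i + r" "r \<in> {3, 4, 5}" and n: "n = 3 * j + s" "s \<in> {3, 4, 5}"
    by (metis three_le_decompose)
  define w where "w = (1 - t\<^sup>2) / 4"
  define p where "p k = pow_sum k t" for k
  have "t\<^sup>2 \<le> 1" using t by (simp add: power_le_one)
  then have w: "0 \<le> w" "w \<le> 1 / 4" by (auto simp: w_def)
  have p: "p 3 = 1 - 3 * w" "p 4 = 1 - 4 * w + 2 * w\<^sup>2" "p 5 = 1 - 5 * w + 5 * w\<^sup>2"
    unfolding p_def w_def by (rule pow_sum_poly)+
  have ww: "w\<^sup>2 * (1 - 4 * w) \<ge> 0" "w * (w\<^sup>2 * (1 - 4 * w)) \<ge> 0" "w ^ 2 \<ge> 0" "w ^ 3 \<ge> 0" "w ^ 4 \<ge> 0"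
    "w * (1 - 4 * w) \<ge> 0"
    using w by simp_all
  have p44: "p 4 * p 4 \<le> p 3 * p 5" and p45: "p 4 * p 5 \<le> p 3 ^ 3" and p55: "p 5 * p 5 \<le> p 3 ^ 2 * p 4"
    using ww unfolding p by (simp_all add: algebra_simps power2_eq_square power3_eq_cube power4_eq_xxxx)
  have p3: "0 \<le> p 3 ^ (i + j)" using t by (simp add: p_def pow_sum_nonneg)
  \<comment> \<open>The pair \<open>k\<close>, \<open>q\<close> normalizes the sum of indices: \<open>r + s = 3 * k + q\<close> with \<open>q\<close> in \<open>{3, 4, 5}\<close>.\<close>
  have key: "p r * p s \<le> p 3 ^ k * p q"
    if "(r, s, k, q) \<in> {(3,3,1,3), (3,4,1,4), (4,3,1,4), (3,5,1,5), (5,3,1,5), (4,4,1,5),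
       (4,5,2,3), (5,4,2,3), (5,5,2,4)}" for k q :: nat
    using that p44 p45 p55 by (auto simp: mult.commute power3_eq_cube power2_eq_square)
  obtain k q :: nat where kq: "(r, s, k, q) \<in> {(3,3,1,3), (3,4,1,4), (4,3,1,4), (3,5,1,5), (5,3,1,5), (4,4,1,5),
       (4,5,2,3), (5,4,2,3), (5,5,2,4)}"
    using m(2) n(2) by auto
  then have q: "q \<in> {3, 4, 5}" "m + n = 3 * (i + j + k) + q" using m(1) n(1) by auto
  have "cycle_bound m t * cycle_bound n t = p 3 ^ (i + j) * (p r * p s)"
    using m n by (simp add: cycle_bound_eq p_def power_add)
  also have "\<dots> \<le> p 3 ^ (i + j) * (p 3 ^ k * p q)"
    using key[OF kq] p3 by (rule mult_left_mono)
  also have "\<dots> = cycle_bound (m + n) t"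
    unfolding q(2) cycle_bound_eq[OF q(1)] by (simp add: p_def power_add)
  finally show ?thesis .
qed auto

lemma prod_cyc_poly_even_le:
  assumes t: "0 \<le> t" "t \<le> 1"
  shows "finite C \<Longrightarrow> card C = 2 * n \<Longrightarrow> (\<And>c. c \<in> C \<Longrightarrow> even (f c) \<and> f c \<ge> 2) \<Longrightarrow>
    (\<Prod>c\<in>C. cyc_poly (f c) t) \<le> cycle_bound (\<Sum>c\<in>C. f c) t \<and> ((\<Sum>c\<in>C. f c) = 0 \<or> (\<Sum>c\<in>C. f c) \<ge> 3)"
proof (induction n arbitrary: C)
  case (Suc n)
  then obtain a C1 where C1: "C = insert a C1" "a \<notin> C1" "card C1 = Suc (2 * n)"
    by (metis card_Suc_eq mult_Suc_right add_2_eq_Suc)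
  then obtain b C2 where C2: "C1 = insert b C2" "b \<notin> C2" "card C2 = 2 * n"
    by (metis card_Suc_eq)
  have fin: "finite C2" using Suc.prems C1 C2 by simp
  have f: "even (f a)" "even (f b)" "f a \<ge> 2" "f b \<ge> 2" using Suc.prems C1 C2 by auto
  have IH: "(\<Prod>c\<in>C2. cyc_poly (f c) t) \<le> cycle_bound (\<Sum>c\<in>C2. f c) t"
    "(\<Sum>c\<in>C2. f c) = 0 \<or> (\<Sum>c\<in>C2. f c) \<ge> 3"
    using Suc.IH[of C2] fin C1 C2 Suc.prems by auto
  have "(\<Prod>c\<in>C. cyc_poly (f c) t) = (cyc_poly (f a) t * cyc_poly (f b) t) * (\<Prod>c\<in>C2. cyc_poly (f c) t)"
    using C1 C2 fin by simp
  also have "\<dots> \<le> cycle_bound (f a + f b) t * cycle_bound (\<Sum>c\<in>C2. f c) t"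
  proof (rule mult_mono)
    show "cyc_poly (f a) t * cyc_poly (f b) t \<le> cycle_bound (f a + f b) t"
      using cyc_poly_even_mult_le[OF t f(1,2)] pow_sum_le_cycle_bound[OF t, of "f a + f b"] f by linarith
  qed (use IH t in \<open>auto intro!: prod_nonneg cycle_bound_nonneg cyc_poly_nonneg\<close>)
  also have "\<dots> \<le> cycle_bound (f a + f b + (\<Sum>c\<in>C2. f c)) t"
    using f IH(2) by (intro cycle_bound_mult_le[OF t]) auto
  finally show ?case using C1 C2 fin f by (simp add: add.assoc)
qed simp

lemma prod_cyc_poly_odd_le:
  assumes t: "0 \<le> t" "t \<le> 1"
  shows "finite C \<Longrightarrow> (\<And>c. c \<in> C \<Longrightarrow> odd (f c) \<and> f c \<ge> 3) \<Longrightarrow>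
    (\<Prod>c\<in>C. cyc_poly (f c) t) \<le> cycle_bound (\<Sum>c\<in>C. f c) t \<and> ((\<Sum>c\<in>C. f c) = 0 \<or> (\<Sum>c\<in>C. f c) \<ge> 3)"
proof (induction C rule: finite_induct)
  case (insert a C)
  have f: "odd (f a)" "f a \<ge> 3" using insert.prems by auto
  have IH: "(\<Prod>c\<in>C. cyc_poly (f c) t) \<le> cycle_bound (\<Sum>c\<in>C. f c) t"
    "(\<Sum>c\<in>C. f c) = 0 \<or> (\<Sum>c\<in>C. f c) \<ge> 3"
    using insert by auto
  have "(\<Prod>c\<in>insert a C. cyc_poly (f c) t) = cyc_poly (f a) t * (\<Prod>c\<in>C. cyc_poly (f c) t)"
    using insert by simp
  also have "\<dots> \<le> cycle_bound (f a) t * cycle_bound (\<Sum>c\<in>C. f c) t"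
    using IH(1) f t
    by (intro mult_mono)
      (auto simp: cyc_poly_odd intro!: prod_nonneg cycle_bound_nonneg cyc_poly_nonneg pow_sum_le_cycle_bound)
  also have "\<dots> \<le> cycle_bound (f a + (\<Sum>c\<in>C. f c)) t"
    using f IH(2) by (intro cycle_bound_mult_le[OF t]) auto
  finally have "(\<Prod>c\<in>insert a C. cyc_poly (f c) t) \<le> cycle_bound (f a + (\<Sum>c\<in>C. f c)) t" .
  moreover have "3 \<le> f a + (\<Sum>c\<in>C. f c)" using f(2) by linarith
  ultimately show ?case using insert.hyps by simp
qed simp

lemma prod_cyc_poly_le_cycle_bound:
  assumes "finite C" and "\<And>c. c \<in> C \<Longrightarrow> f c \<ge> 1" and "even (card {c \<in> C. even (f c)})"
    and t: "0 \<le> t" "t \<le> 1"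
  defines "m \<equiv> \<Sum>c | c \<in> C \<and> f c \<ge> 2. f c"
  shows "(\<Prod>c\<in>C. cyc_poly (f c) t) \<le> cycle_bound m t" and "m = 0 \<or> m \<ge> 3"
proof -
  define Ev Od I where "Ev = {c \<in> C. even (f c)}" and "Od = {c \<in> C. odd (f c) \<and> f c \<ge> 3}"
    and "I = {c \<in> C. f c = Suc 0}"
  have cases: "even (f c) \<and> f c \<ge> 2 \<or> odd (f c) \<and> f c \<ge> 3 \<or> f c = Suc 0" if "c \<in> C" for c
    using assms(2)[OF that] by presburger
  then have C: "C = Ev \<union> Od \<union> I" and C2: "{c \<in> C. f c \<ge> 2} = Ev \<union> Od"
    by (fastforce simp: Ev_def Od_def I_def)+
  have disj: "Ev \<inter> Od = {}" "(Ev \<union> Od) \<inter> I = {}" by (auto simp: Ev_def Od_def I_def)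
  have fin: "finite Ev" "finite Od" "finite I" using assms(1) by (auto simp: Ev_def Od_def I_def)
  obtain n where "card Ev = 2 * n" using assms(3) unfolding Ev_def by (elim evenE)
  moreover have "even (f c) \<and> f c \<ge> 2" if "c \<in> Ev" for c
    using that cases[of c] by (auto simp: Ev_def)
  ultimately have Ev: "(\<Prod>c\<in>Ev. cyc_poly (f c) t) \<le> cycle_bound (\<Sum>c\<in>Ev. f c) t"
    "(\<Sum>c\<in>Ev. f c) = 0 \<or> (\<Sum>c\<in>Ev. f c) \<ge> 3"
    using prod_cyc_poly_even_le[OF t fin(1), of n f] by auto
  have Od: "(\<Prod>c\<in>Od. cyc_poly (f c) t) \<le> cycle_bound (\<Sum>c\<in>Od. f c) t"
    "(\<Sum>c\<in>Od. f c) = 0 \<or> (\<Sum>c\<in>Od. f c) \<ge> 3"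
    using prod_cyc_poly_odd_le[OF t fin(2), of f] by (auto simp: Od_def)
  have m: "m = (\<Sum>c\<in>Ev. f c) + (\<Sum>c\<in>Od. f c)"
    unfolding m_def C2 using fin disj by (simp add: sum.union_disjoint)
  have "(\<Prod>c\<in>C. cyc_poly (f c) t) = (\<Prod>c\<in>Ev. cyc_poly (f c) t) * (\<Prod>c\<in>Od. cyc_poly (f c) t)"
    unfolding C using fin disj by (simp add: prod.union_disjoint I_def)
  also have "\<dots> \<le> cycle_bound (\<Sum>c\<in>Ev. f c) t * cycle_bound (\<Sum>c\<in>Od. f c) t"
    using Ev(1) Od(1) t by (intro mult_mono) (auto intro!: prod_nonneg cycle_bound_nonneg cyc_poly_nonneg)
  also have "\<dots> \<le> cycle_bound m t"
    unfolding m by (intro cycle_bound_mult_le[OF t] Ev Od)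
  finally show "(\<Prod>c\<in>C. cyc_poly (f c) t) \<le> cycle_bound m t" .
  show "m = 0 \<or> m \<ge> 3" using Ev(2) Od(2) m by auto
qed

section \<open>Bounding the integral from above\<close>

definition pow_sum_integral :: "nat \<Rightarrow> nat \<Rightarrow> real" where
  "pow_sum_integral u n = integral {0..1} (\<lambda>t. pow_sum 3 t ^ u * pow_sum n t)"

lemma pow_sum_integrable: "(\<lambda>t. pow_sum 3 t ^ u * pow_sum n t) integrable_on {0..1}"
  by (intro integrable_continuous_real continuous_intros)

text \<open>
As \<open>t = X - Y\<close>, the operator \<open>t * d/dt\<close> maps the functions \<open>pow_sum n\<close> into their own linear span.
This is why the integrals below satisfy recurrences.
\<close>

lemma pow_sum_has_derivative:
  assumes "n \<ge> 1"
  obtains d where "(pow_sum n has_real_derivative d) (at t)"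
    and "t * d = n * pow_sum n t - n / 2 * pow_sum (n - 1) t"
proof -
  obtain k where n: "n = Suc k" using assms by (cases n) auto
  define X Y where "X = (1 + t) / 2" and "Y = (1 - t) / 2"
  have XY: "t = X - Y" "Y = 1 - X" by (simp_all add: X_def Y_def field_simps)
  have "((\<lambda>t. ((1 + t) / 2) ^ n) has_real_derivative n * (1 / 2) * ((1 + t) / 2) ^ (n - 1)) (at t)"
    "((\<lambda>t. ((1 - t) / 2) ^ n) has_real_derivative n * (- (1 / 2)) * ((1 - t) / 2) ^ (n - 1)) (at t)"
    by (auto intro!: derivative_eq_intros)
  from DERIV_add[OF this]
  have "(pow_sum n has_real_derivative n / 2 * (X ^ k - Y ^ k)) (at t)"
    by (simp add: pow_sum_def[abs_def] X_def Y_def n algebra_simps)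
  moreover have "t * (n / 2 * (X ^ k - Y ^ k)) = n * pow_sum n t - n / 2 * pow_sum (n - 1) t"
  proof -
    have "(X - Y) * (X ^ k - Y ^ k) = 2 * (X ^ Suc k + Y ^ Suc k) - (X ^ k + Y ^ k)"
      unfolding XY(2) by (simp add: algebra_simps)
    then have "n / 2 * ((X - Y) * (X ^ k - Y ^ k)) = n / 2 * (2 * (X ^ Suc k + Y ^ Suc k) - (X ^ k + Y ^ k))"
      by simp
    moreover have "pow_sum n t = X ^ Suc k + Y ^ Suc k" "pow_sum (n - 1) t = X ^ k + Y ^ k"
      by (simp_all add: pow_sum_def n X_def Y_def)
    ultimately show ?thesis by (simp add: algebra_simps flip: XY(1))
  qed
  ultimately show thesis by (rule that)
qed

text \<open>
Integration by parts: the derivative of \<open>t * p\<^sub>3\<^sup>u p\<^sub>n\<close> integrates to the value 1 at the right end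
point. Multiples of \<open>p\<^sub>2\<close> that arise from differentiating \<open>p\<^sub>3\<close> are removed with
\<open>3 p\<^sub>2 = 2 p\<^sub>3 + 1\<close>.
\<close>

lemma pow_sum_integral_rec:
  assumes "n \<ge> 1"
  shows "(1 + 2 * real u + real n) * pow_sum_integral u n =
    1 + u / 2 * pow_sum_integral (u - 1) n + n / 2 * pow_sum_integral u (n - 1)"
proof -
  define E where "E t = (1 + 2 * real u + real n) * (pow_sum 3 t ^ u * pow_sum n t)
     - u / 2 * (pow_sum 3 t ^ (u - 1) * pow_sum n t) - n / 2 * (pow_sum 3 t ^ u * pow_sum (n - 1) t)" for t
  have deriv: "((\<lambda>t. t * (pow_sum 3 t ^ u * pow_sum n t)) has_real_derivative E t) (at t)" for t
  proof -
    obtain d where d: "(pow_sum n has_real_derivative d) (at t)"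
      "t * d = n * pow_sum n t - n / 2 * pow_sum (n - 1) t"
      using pow_sum_has_derivative[OF assms] by metis
    obtain d3 where d3: "(pow_sum 3 has_real_derivative d3) (at t)"
      "t * d3 = (3::nat) * pow_sum 3 t - (3::nat) / 2 * pow_sum (3 - 1) t"
      using pow_sum_has_derivative[of 3] by (metis one_le_numeral)
    have "t * d3 = 3 * pow_sum 3 t - 3 / 2 * pow_sum 2 t" using d3(2) by simp
    then have d3': "t * d3 = 2 * pow_sum 3 t - 1 / 2" by (simp add: pow_sum_poly field_simps)
    have "((\<lambda>t. t * (pow_sum 3 t ^ u * pow_sum n t)) has_real_derivative
       pow_sum 3 t ^ u * pow_sum n t + u * pow_sum 3 t ^ (u - 1) * (t * d3) * pow_sum n t
        + pow_sum 3 t ^ u * (t * d)) (at t)"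
      by (auto intro!: derivative_eq_intros d(1) d3(1) simp: algebra_simps)
    also have "u * pow_sum 3 t ^ (u - 1) * (t * d3) * pow_sum n t =
        (2 * u * pow_sum 3 t ^ u - u / 2 * pow_sum 3 t ^ (u - 1)) * pow_sum n t"
      unfolding d3' by (cases u) (auto simp: algebra_simps)
    finally show ?thesis
      unfolding E_def d(2) by (simp add: algebra_simps)
  qed
  have "((\<lambda>t. t * (pow_sum 3 t ^ u * pow_sum n t)) has_vector_derivative E t) (at t within {0..1})" for t
    unfolding has_real_derivative_iff_has_vector_derivative[symmetric]
    by (rule has_field_derivative_at_within[OF deriv])
  then have "(E has_integral 1 * (pow_sum 3 1 ^ u * pow_sum n 1) - 0 * (pow_sum 3 0 ^ u * pow_sum n 0)) {0..1}"
    by (intro fundamental_theorem_of_calculus) auto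
  moreover have "pow_sum k 1 = 1" if "k \<ge> 1" for k
    using that by (simp add: pow_sum_def)
  ultimately have "(E has_integral 1) {0..1}" using assms by simp
  moreover have "(E has_integral ((1 + 2 * real u + real n) * pow_sum_integral u n
     - u / 2 * pow_sum_integral (u - 1) n - n / 2 * pow_sum_integral u (n - 1))) {0..1}"
    unfolding E_def pow_sum_integral_def
    by (intro has_integral_diff has_integral_mult_right integrable_integral pow_sum_integrable)
  ultimately have "1 = (1 + 2 * real u + real n) * pow_sum_integral u n
     - u / 2 * pow_sum_integral (u - 1) n - n / 2 * pow_sum_integral u (n - 1)"
    by (rule has_integral_unique)
  then show ?thesis by linarith
qed

lemma pow_sum_integral_0: "pow_sum_integral 0 n = 2 / (real n + 1)"
proof (induction n)
  case 0
  show ?case by (simp add: pow_sum_integral_def pow_sum_poly)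
next
  case (Suc n)
  have "(real n + 2) * pow_sum_integral 0 (Suc n) = 2"
    using pow_sum_integral_rec[of "Suc n" 0] Suc by (simp add: field_simps)
  then show ?case by (simp add: field_simps)
qed

lemma pow_sum_integral_3_rec:
  "(2 * real u + 5) * pow_sum_integral (Suc u) 3 = 1 + (real u + 2) / 2 * pow_sum_integral u 3"
proof -
  have "pow_sum_integral (Suc u) 2 = integral {0..1} (\<lambda>t. 2 / 3 * (pow_sum 3 t ^ Suc u * pow_sum 3 t) +
      1 / 3 * (pow_sum 3 t ^ u * pow_sum 3 t))"
    unfolding pow_sum_integral_def
    by (intro integral_cong) (simp add: pow_sum_poly field_simps)
  also have "\<dots> = 2 / 3 * pow_sum_integral (Suc u) 3 + 1 / 3 * pow_sum_integral u 3"
    unfolding pow_sum_integral_def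
    by (intro integral_unique has_integral_add has_integral_mult_right integrable_integral pow_sum_integrable)
  finally have "pow_sum_integral (Suc u) 2 = 2 / 3 * pow_sum_integral (Suc u) 3 + 1 / 3 * pow_sum_integral u 3" .
  then show ?thesis
    using pow_sum_integral_rec[of 3 "Suc u"] by (simp add: field_simps)
qed

text \<open>
With \<open>n = 3 u + 3\<close> the right-hand side is \<open>2 / (n + 19/29)\<close>. The induction step needs
\<open>(1 - c) n \<ge> (2 - c) (3 - c)\<close> for \<open>c = 19/29\<close> at the new \<open>n\<close>, that is \<open>n \<ge> 9.15\<close>. The induction
therefore starts from \<open>u = 2\<close>, where equality holds; this is the case that determines \<open>19/29\<close>.
\<close>

lemma pow_sum_integral_3_le: "pow_sum_integral u 3 \<le> 58 / (87 * real u + 106)"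
proof -
  have 0: "pow_sum_integral 0 3 = 1 / 2" by (simp add: pow_sum_integral_0)
  have 1: "pow_sum_integral 1 3 = 3 / 10" using pow_sum_integral_3_rec[of 0] 0 by simp
  have 2: "pow_sum_integral 2 3 = 29 / 140"
    using pow_sum_integral_3_rec[of 1] 1 by (simp add: numeral_2_eq_2)
  have ge2: "pow_sum_integral (v + 2) 3 \<le> 58 / (87 * real (v + 2) + 106)" for v
  proof (induction v)
    case 0
    show ?case using 2 by (simp add: numeral_2_eq_2)
  next
    case (Suc v)
    define x where "x = real v"
    have x: "x \<ge> 0" by (simp add: x_def)
    have "(2 * x + 9) * pow_sum_integral (Suc v + 2) 3 = 1 + (x + 4) / 2 * pow_sum_integral (v + 2) 3"
      using pow_sum_integral_3_rec[of "v + 2"] by (simp add: x_def algebra_simps)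
    also have "\<dots> \<le> 1 + (x + 4) / 2 * (58 / (87 * x + 280))"
      using Suc x by (intro add_left_mono mult_left_mono) (auto simp: x_def algebra_simps)
    also have "\<dots> \<le> (2 * x + 9) * (58 / (87 * x + 367))"
      using x by (simp add: divide_simps) (simp add: algebra_simps)
    finally have "pow_sum_integral (Suc v + 2) 3 \<le> 58 / (87 * x + 367)"
      using x by (subst (asm) mult_le_cancel_left_pos) auto
    then show ?case by (simp add: x_def algebra_simps)
  qed
  show ?thesis
  proof (cases "u \<ge> 2")
    case True
    then show ?thesis using ge2[of "u - 2"] by (simp only: le_add_diff_inverse2)
  next
    case False
    then have "u = 0 \<or> u = 1" by linarith
    then show ?thesis using 0 1 by auto
  qed
qed

text \<open>
Again the right-hand side is \<open>2 / (n + 19/29)\<close>, now with \<open>n = 3 u + 4\<close>. The recurrence expresses the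
integral through the previous one and one of the integrals just estimated. The estimate is not sharp
here, so the induction can start from \<open>u = 0\<close>; the same holds for \<open>n = 3 u + 5\<close> below.
\<close>

lemma pow_sum_integral_4_le: "pow_sum_integral u 4 \<le> 58 / (87 * real u + 135)"
proof (induction u)
  case 0
  show ?case by (simp add: pow_sum_integral_0)
next
  case (Suc u)
  define x where "x = real u"
  have x: "x \<ge> 0" by (simp add: x_def)
  have "(2 * x + 7) * pow_sum_integral (Suc u) 4 =
      1 + (x + 1) / 2 * pow_sum_integral u 4 + 2 * pow_sum_integral (Suc u) 3"
    using pow_sum_integral_rec[of 4 "Suc u"] by (simp add: x_def algebra_simps)
  also have "\<dots> \<le> 1 + (x + 1) / 2 * (58 / (87 * x + 135)) + 2 * (58 / (87 * x + 193))"
    using Suc pow_sum_integral_3_le[of "Suc u"] x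
    by (intro add_mono mult_left_mono) (auto simp: x_def algebra_simps)
  also have "\<dots> \<le> (2 * x + 7) * (58 / (87 * x + 222))"
    using x by (simp add: divide_simps) (simp add: algebra_simps)
  finally have "pow_sum_integral (Suc u) 4 \<le> 58 / (87 * x + 222)"
    using x by (subst (asm) mult_le_cancel_left_pos) auto
  then show ?case by (simp add: x_def algebra_simps)
qed

lemma pow_sum_integral_5_le: "pow_sum_integral u 5 \<le> 58 / (87 * real u + 164)"
proof (induction u)
  case 0
  show ?case by (simp add: pow_sum_integral_0)
next
  case (Suc u)
  define x where "x = real u"
  have x: "x \<ge> 0" by (simp add: x_def)
  have "(2 * x + 8) * pow_sum_integral (Suc u) 5 =
      1 + (x + 1) / 2 * pow_sum_integral u 5 + 5 / 2 * pow_sum_integral (Suc u) 4"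
    using pow_sum_integral_rec[of 5 "Suc u"] by (simp add: x_def algebra_simps)
  also have "\<dots> \<le> 1 + (x + 1) / 2 * (58 / (87 * x + 164)) + 5 / 2 * (58 / (87 * x + 222))"
    using Suc pow_sum_integral_4_le[of "Suc u"] x
    by (intro add_mono mult_left_mono) (auto simp: x_def algebra_simps)
  also have "\<dots> \<le> (2 * x + 8) * (58 / (87 * x + 251))"
    using x by (simp add: divide_simps) (simp add: algebra_simps)
  finally have "pow_sum_integral (Suc u) 5 \<le> 58 / (87 * x + 251)"
    using x by (subst (asm) mult_le_cancel_left_pos) auto
  then show ?case by (simp add: x_def algebra_simps)
qed

lemma cycle_bound_integral_le:
  assumes "m = 0 \<or> m \<ge> 3"
  shows "integral {0..1} (cycle_bound m) \<le> 2 / (real m + 19 / 29)"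
proof (cases "m = 0")
  case True
  then have "cycle_bound m = (\<lambda>t. 1)" by auto
  then show ?thesis using True by simp
next
  case False
  then obtain i r where m: "m = 3 * i + r" "r \<in> {3, 4, 5}"
    using assms three_le_decompose by metis
  have "integral {0..1} (cycle_bound m) = pow_sum_integral i r"
    unfolding m(1) pow_sum_integral_def cycle_bound_eq[OF m(2), abs_def] ..
  also have "\<dots> \<le> 58 / (87 * real i + (29 * real r + 19))"
    using m(2) pow_sum_integral_3_le[of i] pow_sum_integral_4_le[of i] pow_sum_integral_5_le[of i] by auto
  also have "\<dots> = 2 / (real m + 19 / 29)"
    by (simp add: m(1) field_simps)
  finally show ?thesis .
qed

text \<open>
The hypothesis that the integral is not zero says that \<open>D\<close> has an even number of even cycles, which
is what allows folding the integral onto \<open>[0, 1]\<close> and pairing the even cycles.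
\<close>

lemma cycle_integral_bounds:
  assumes C: "cycle_lists D S C" and "cycle_integral C \<noteq> 0"
  defines "m \<equiv> real (card S) - real (card {xs \<in> C. length xs = 1})"
  shows "2 / (m + 2) \<le> cycle_integral C" and "cycle_integral C \<le> 2 / (m + 19 / 29)"
proof -
  define k where "k = (\<Sum>xs | xs \<in> C \<and> length xs \<ge> 2. length xs)"
  have fin: "finite C" and len: "\<And>xs. xs \<in> C \<Longrightarrow> length xs \<ge> 1"
    using C by (auto simp: cycle_lists_def cycle_list_def Suc_le_eq)
  have "card S = (\<Sum>xs\<in>C. length xs)" by (rule card_cycle_lists(1)[OF C])
  also have "C = {xs \<in> C. length xs \<ge> 2} \<union> {xs \<in> C. length xs = 1}"
    using len by force
  also have "sum length \<dots> = k + card {xs \<in> C. length xs = 1}"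
    using fin by (subst sum.union_disjoint) (auto simp: k_def)
  finally have m: "m = real k" by (simp add: m_def)
  define F where "F t = (\<Prod>xs\<in>C. cyc_poly (length xs) t)" for t
  have even: "even (card {xs \<in> C. even (length xs)})" and eq: "cycle_integral C = integral {0..1} F"
    using assms(2) integral_cyc_poly_reflect[OF fin, of length]
    unfolding cycle_integral_def F_def by (auto split: if_splits)
  have F: "(F has_integral cycle_integral C) {0..1}"
    unfolding eq F_def by (intro integrable_integral integrable_cyc_poly_prod)
  show "2 / (m + 2) \<le> cycle_integral C"
    using has_integral_sqrt_power[of k] F unfolding m
    by (rule has_integral_le) (simp add: F_def k_def prod_cyc_poly_ge_sqrt_power[OF fin len])
  have "cycle_integral C \<le> integral {0..1} (cycle_bound k)"
  proof (rule has_integral_le[OF F])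
    show "(cycle_bound k has_integral integral {0..1} (cycle_bound k)) {0..1}"
      by (intro integrable_integral integrable_continuous_real continuous_intros)
    show "F t \<le> cycle_bound k t" if "t \<in> {0..1}" for t
      using prod_cyc_poly_le_cycle_bound(1)[OF fin len even] that by (simp add: F_def k_def)
  qed
  also have "\<dots> \<le> 2 / (m + 19 / 29)"
    unfolding m using prod_cyc_poly_le_cycle_bound(2)[OF fin len even, of 0]
    by (intro cycle_bound_integral_le) (simp add: k_def)
  finally show "cycle_integral C \<le> 2 / (m + 19 / 29)" .
qed

section \<open>Faces after a rearrangement\<close>

lemma cyclic_on_imp_permutes:
  assumes "cyclic_on f S" and "\<And>x. x \<notin> S \<Longrightarrow> f x = x"
  shows "f permutes S"
proof (rule bij_imp_permutes[OF bij_betw_imageI])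
  have fin: "finite S" using assms(1) by (rule finite_cyclic_on)
  show image: "f ` S = S"
  proof
    show "f ` S \<subseteq> S" using assms(1) by (auto intro: cyclic_on_inI)
    show "S \<subseteq> f ` S"
    proof
      fix s assume s: "s \<in> S"
      then have "s \<in> orbit f s" using orbit_cyclic_eq3[OF assms(1)] by blast
      then show "s \<in> f ` S"
        using orbit_cyclic_eq3[OF assms(1) s] s by cases auto
    qed
  qed
  show "inj_on f S" using fin image by (simp add: eq_card_imp_inj_on)
qed (use assms in auto)

lemma delete_outside_first_return:
  assumes "x \<in> S" and "(f ^^ n) x \<in> S" and "n > 0" and "\<And>i. 0 < i \<Longrightarrow> i < n \<Longrightarrow> (f ^^ i) x \<notin> S"
  shows "delete_outside f S x = (f ^^ n) x"
proof -
  have "(LEAST n. n > 0 \<and> (f ^^ n) x \<in> S) = n"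
    using assms(2-4) by (intro Least_equality) (auto simp: not_less[symmetric])
  then show ?thesis using assms(1) by (simp add: delete_outside_def)
qed

lemma first_return_exists:
  assumes "permutation f" and "x \<in> S"
  obtains n where "n > 0" "(f ^^ n) x \<in> S" "\<And>i. 0 < i \<Longrightarrow> i < n \<Longrightarrow> (f ^^ i) x \<notin> S"
    "delete_outside f S x = (f ^^ n) x"
proof -
  define n where "n = (LEAST n. n > 0 \<and> (f ^^ n) x \<in> S)"
  obtain k where "k > 0" "x = (f ^^ k) x"
    using permutation_self_in_orbit[OF assms(1), of x] by (auto simp: orbit_altdef)
  then have "\<exists>n. n > 0 \<and> (f ^^ n) x \<in> S" using assms(2) by metis
  then have "n > 0 \<and> (f ^^ n) x \<in> S" unfolding n_def by (rule LeastI_ex)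
  moreover have "(f ^^ i) x \<notin> S" if "0 < i" "i < n" for i
    using not_less_Least[of i "\<lambda>n. n > 0 \<and> (f ^^ n) x \<in> S"] that by (auto simp: n_def)
  ultimately show thesis using that delete_outside_first_return[OF assms(2)] by blast
qed

text \<open>
The permutation \<open>\<tau>\<close> acts only at the first step, since the path from \<open>\<tau> x\<close> back to \<open>H\<close> under \<open>f\<close> stays
outside \<open>H\<close> until its end.
\<close>

lemma delete_outside_comp:
  assumes "permutation f" and "\<tau> permutes H" and "x \<in> H"
  shows "delete_outside (f \<circ> \<tau>) H x = delete_outside f H (\<tau> x)"
proof -
  have \<tau>x: "\<tau> x \<in> H" using assms by (simp add: permutes_in_image)
  obtain n where n: "n > 0" "(f ^^ n) (\<tau> x) \<in> H" "\<And>i. 0 < i \<Longrightarrow> i < n \<Longrightarrow> (f ^^ i) (\<tau> x) \<notin> H"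
    "delete_outside f H (\<tau> x) = (f ^^ n) (\<tau> x)"
    using first_return_exists[OF assms(1) \<tau>x] by blast
  have *: "((f \<circ> \<tau>) ^^ Suc i) x = (f ^^ Suc i) (\<tau> x)" if "i < n" for i
    using that
  proof (induction i)
    case (Suc i)
    then have "\<tau> ((f ^^ Suc i) (\<tau> x)) = (f ^^ Suc i) (\<tau> x)"
      using n(3)[of "Suc i"] assms(2) by (intro permutes_not_in) auto
    then show ?case using Suc by simp
  qed simp
  then have **: "((f \<circ> \<tau>) ^^ i) x = (f ^^ i) (\<tau> x)" if "0 < i" "i \<le> n" for i
    using that by (cases i) (auto simp del: funpow.simps)
  show ?thesis
    using n ** assms(3) by (subst delete_outside_first_return[where x = x and S = H and n = n]) auto
qed

text \<open>
Deleting elements from the cycles of \<open>f\<close> preserves the number of cycles as long as no cycle is lost.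
\<close>

lemma cyclic_on_delete_outside:
  assumes "f permutes S" and "finite S" and "H \<subseteq> S" and "H \<noteq> {}"
    and meets: "\<And>s. s \<in> S \<Longrightarrow> orbit f s \<inter> H \<noteq> {}"
  shows "cyclic_on f S \<longleftrightarrow> cyclic_on (delete_outside f H) H"
proof -
  let ?g = "delete_outside f H"
  have perm: "permutation f" using assms(1,2) permutation_permutes by blast
  show ?thesis
  proof
    assume cyc: "cyclic_on f S"
    have reach: "(f ^^ k) h \<in> orbit ?g h" if "h \<in> H" "k > 0" "(f ^^ k) h \<in> H" for k h
      using that
    proof (induction k arbitrary: h rule: less_induct)
      case (less k)
      obtain n where n: "n > 0" "(f ^^ n) h \<in> H" "\<And>i. 0 < i \<Longrightarrow> i < n \<Longrightarrow> (f ^^ i) h \<notin> H"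
        "?g h = (f ^^ n) h"
        using first_return_exists[OF perm less.prems(1)] by blast
      have "n \<le> k" using n(3)[of k] less.prems by force
      show ?case
      proof (cases "n = k")
        case True
        then show ?thesis using n(4) by (metis orbit.base)
      next
        case False
        then have "(f ^^ k) h = (f ^^ (k - n)) (?g h)"
          using \<open>n \<le> k\<close> n(4) by (metis add.commute comp_apply funpow_add le_add_diff_inverse)
        moreover have "(f ^^ (k - n)) (?g h) \<in> orbit ?g (?g h)"
          using less.IH[of "k - n" "?g h"] n less.prems False \<open>n \<le> k\<close> calculation by auto
        ultimately show ?thesis by (metis orbit_subset)
      qed
    qed
    obtain h where h: "h \<in> H" using assms(4) by blast
    have "orbit ?g h = H"
    proof
      have closed: "?g x \<in> H" if "x \<in> H" for x
        using first_return_exists[OF perm that] by metis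
      show "orbit ?g h \<subseteq> H"
      proof
        fix y assume "y \<in> orbit ?g h"
        then show "y \<in> H" by induction (use h closed in auto)
      qed
      show "H \<subseteq> orbit ?g h"
      proof
        fix y assume y: "y \<in> H"
        have "h \<in> S" using h assms(3) by blast
        then have "orbit f h = S" by (rule orbit_cyclic_eq3[OF cyc])
        then have "y \<in> orbit f h" using y assms(3) by blast
        then show "y \<in> orbit ?g h" using reach h y by (auto simp: orbit_altdef[of f])
      qed
    qed
    then show "cyclic_on ?g H" using h by (metis cyclic_on_singleI)
  next
    assume cyc: "cyclic_on ?g H"
    obtain h where h: "h \<in> H" using assms(4) by blast
    have sub: "orbit ?g h \<subseteq> orbit f h"
    proof
      have return: "?g x \<in> orbit f x" if "x \<in> H" for x
        using first_return_exists[OF perm that] by (auto simp: orbit_altdef)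
      have H: "orbit ?g h = H" using cyc h by (rule orbit_cyclic_eq3)
      fix y assume "y \<in> orbit ?g h"
      then show "y \<in> orbit f h"
      proof induction
        case base
        show ?case using h by (rule return)
      next
        case (step y)
        then show ?case using return H by (metis orbit_trans)
      qed
    qed
    have "orbit f h = S"
    proof
      show "orbit f h \<subseteq> S" using assms(1,3) h by (intro permutes_orbit_subset) auto
      show "S \<subseteq> orbit f h"
      proof
        fix s assume "s \<in> S"
        then obtain y where y: "y \<in> orbit f s" "y \<in> H" using meets by blast
        then have "s \<in> orbit f y"
          using orbit_swap permutation_self_in_orbit[OF perm] by metis
        moreover have "y \<in> orbit f h" using sub y orbit_cyclic_eq3[OF cyc h] by blast
        ultimately show "s \<in> orbit f h" by (rule orbit_trans)
      qed
    qed
    then show "cyclic_on f S" using h assms(3) by (metis cyclic_on_singleI subsetD)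
  qed
qed

text \<open>
An orbit that avoids \<open>H\<close> is not affected by \<open>\<tau>\<close>, so it would be an orbit of \<open>f\<close>, which has only one.
\<close>

lemma orbit_comp_meets:
  assumes "f permutes S" and "finite S" and "cyclic_on f S" and "\<tau> permutes H" and "H \<subseteq> S" and "H \<noteq> {}"
    and "s \<in> S"
  shows "orbit (f \<circ> \<tau>) s \<inter> H \<noteq> {}"
proof
  assume disj: "orbit (f \<circ> \<tau>) s \<inter> H = {}"
  have "\<tau> permutes S" using assms(4,5) by (rule permutes_subset)
  then have "permutation (f \<circ> \<tau>)"
    using assms(1,2) permutation_permutes permutes_compose by blast
  then have "s \<in> orbit (f \<circ> \<tau>) s" by (rule permutation_self_in_orbit)
  moreover have "f z = (f \<circ> \<tau>) z" if "z \<in> orbit (f \<circ> \<tau>) s" for z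
  proof -
    have "z \<notin> H" using that disj by blast
    then show ?thesis using permutes_not_in[OF assms(4)] by simp
  qed
  ultimately have "orbit f s = orbit (f \<circ> \<tau>) s" by (rule orbit_cong)
  moreover have "orbit f s = S" using assms(3,7) by (rule orbit_cyclic_eq3)
  ultimately show False using disj assms(5,6) by blast
qed

text \<open>
Changing the rotation at \<open>v\<close> from \<open>\<pi>\<close> to \<open>\<theta>\<close> multiplies the vertex permutation, and hence \<open>\<gamma>\<close>, on the
right by \<open>\<tau> = inv \<pi> \<circ> \<theta>\<close>. With \<open>s\<close> obtained from \<open>\<gamma>\<close> by deleting everything outside \<open>H\<close>, the new
embedding has one face iff \<open>s \<circ> \<tau> = D \<circ> \<theta>\<close> is a cycle on \<open>H\<close>. For \<open>\<tau> = id\<close> the same equivalence shows that \<open>s\<close> itself is a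
cycle, so \<open>D\<close> is a permutation of \<open>H\<close>.
\<close>

lemma one_face_rearrange_iff:
  assumes "is_graph G" and "embedding_of G E" and "one_face G E" and v: "v \<in> verts G"
  defines "H \<equiv> incident G v" and "D \<equiv> D_at G E v"
  shows "D permutes H" and "pi_at G E v \<in> cyclic_orders H" and "cyclic_on (D \<circ> pi_at G E v) H"
    and "\<theta> permutes H \<Longrightarrow> one_face G (rearrange G E v \<theta>) \<longleftrightarrow> cyclic_on (D \<circ> \<theta>) H"
proof -
  define S where "S = half_edges G"
  define \<beta> where "\<beta> = vertex_perm E"
  define \<gamma> where "\<gamma> = face_perm E"
  define \<pi> where "\<pi> = pi_at G E v"
  define s where "s = s_at G E v"
  have fin: "finite S" by (simp add: S_def half_edges_def)
  have HS: "H \<subseteq> S" by (auto simp: H_def S_def incident_def)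
  have \<gamma>: "\<gamma> = opposite G \<circ> \<beta>" and \<beta>: "\<beta> permutes S" and cyc\<beta>: "cyclic_on \<beta> H"
    using assms(2) v by (auto simp: embedding_of_def \<gamma>_def \<beta>_def S_def H_def)
  have "opposite G permutes S" using assms(1) by (simp add: is_graph_def S_def)
  then have \<gamma>S: "\<gamma> permutes S" unfolding \<gamma> using \<beta> by (intro permutes_compose)
  have perm: "permutation \<gamma>" using \<gamma>S fin permutation_permutes by blast
  have cyc\<gamma>: "cyclic_on \<gamma> S" using assms(3) by (simp add: one_face_def \<gamma>_def S_def)
  have ne: "H \<noteq> {}" using cyc\<beta> by (auto simp: cyclic_on_def)
  have \<pi>_eq: "\<pi> = perm_restrict \<beta> H" by (simp add: \<pi>_def pi_at_def \<beta>_def H_def)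
  have cyc\<pi>: "cyclic_on \<pi> H" unfolding \<pi>_eq cyclic_on_perm_restrict by (rule cyc\<beta>)
  then have \<pi>H: "\<pi> permutes H"
    by (rule cyclic_on_imp_permutes) (simp add: \<pi>_eq perm_restrict_simps)
  have s_eq: "s = delete_outside \<gamma> H" by (simp add: s_def s_at_def \<gamma>_def H_def)
  have return: "cyclic_on (\<gamma> \<circ> \<tau>) S \<longleftrightarrow> cyclic_on (s \<circ> \<tau>) H" if \<tau>: "\<tau> permutes H" for \<tau>
  proof -
    have "\<gamma> \<circ> \<tau> permutes S"
      using \<tau> \<gamma>S HS by (meson permutes_compose permutes_subset)
    then have "cyclic_on (\<gamma> \<circ> \<tau>) S \<longleftrightarrow> cyclic_on (delete_outside (\<gamma> \<circ> \<tau>) H) H"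
      using fin HS ne orbit_comp_meets[OF \<gamma>S fin cyc\<gamma> \<tau> HS ne]
      by (intro cyclic_on_delete_outside)
    also have "\<dots> \<longleftrightarrow> cyclic_on (s \<circ> \<tau>) H"
      by (intro cyclic_cong) (simp add: s_eq delete_outside_comp[OF perm \<tau>])
    finally show ?thesis .
  qed
  have cycs: "cyclic_on s H" using return[of id] cyc\<gamma> permutes_id by simp
  then have sH: "s permutes H"
    by (rule cyclic_on_imp_permutes) (simp add: s_eq delete_outside_def)
  have D: "D = s \<circ> inv \<pi>" by (simp add: D_def D_at_def s_def \<pi>_def)
  show "D permutes H" unfolding D using sH \<pi>H by (intro permutes_compose permutes_inv)
  show "pi_at G E v \<in> cyclic_orders H"
    using cyc\<pi> \<pi>H by (simp add: cyclic_orders_def flip: \<pi>_def)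
  have "D \<circ> \<pi> = s" unfolding D using \<pi>H by (simp add: comp_assoc permutes_inv_o)
  then show "cyclic_on (D \<circ> pi_at G E v) H" using cycs by (simp flip: \<pi>_def)
  assume \<theta>: "\<theta> permutes H"
  define \<tau> where "\<tau> = inv \<pi> \<circ> \<theta>"
  have \<tau>: "\<tau> permutes H" unfolding \<tau>_def using \<theta> \<pi>H by (intro permutes_compose permutes_inv)
  have "override_on \<beta> \<theta> H = \<beta> \<circ> \<tau>"
  proof
    fix x
    show "override_on \<beta> \<theta> H x = (\<beta> \<circ> \<tau>) x"
    proof (cases "x \<in> H")
      case True
      then have "\<tau> x \<in> H" using \<tau> by (simp add: permutes_in_image)
      then have "\<beta> (\<tau> x) = \<pi> (\<tau> x)" by (simp add: \<pi>_eq perm_restrict_simps)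
      also have "\<dots> = \<theta> x" using \<pi>H by (simp add: \<tau>_def permutes_inverses)
      finally show ?thesis using True by simp
    next
      case False
      then show ?thesis using \<tau> by (simp add: permutes_not_in)
    qed
  qed
  moreover have "edge_perm E = opposite G" using assms(2) by (simp add: embedding_of_def)
  ultimately have "face_perm (rearrange G E v \<theta>) = \<gamma> \<circ> \<tau>"
    by (simp add: rearrange_def Let_def \<gamma> comp_assoc flip: \<beta>_def H_def)
  moreover have "D \<circ> \<theta> = s \<circ> \<tau>" by (simp add: D \<tau>_def comp_assoc)
  ultimately show "one_face G (rearrange G E v \<theta>) \<longleftrightarrow> cyclic_on (D \<circ> \<theta>) H"
    using return[OF \<tau>] by (simp add: one_face_def flip: S_def)
qed

text \<open>
The integral is positive because \<open>\<theta> = \<pi>\<^sub>v\<close> returns the original embedding.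
\<close>

lemma prob1_eq_cycle_integral:
  assumes "is_graph G" and "embedding_of G E" and "one_face G E" and "v \<in> verts G"
    and C: "cycle_lists (D_at G E v) (incident G v) C"
  shows "prob1 G E v = cycle_integral C" and "cycle_integral C \<noteq> 0"
proof -
  define H where "H = incident G v"
  define D where "D = D_at G E v"
  note facts = one_face_rearrange_iff[OF assms(1-4), folded H_def D_def]
  have fin: "finite H" by (simp add: H_def incident_def half_edges_def)
  have ne: "H \<noteq> {}" using facts(2) by (auto simp: cyclic_orders_def cyclic_on_def)
  have card: "card (cyclic_orders H) = fact (card H - 1)" using fin ne by (rule card_cyclic_orders)
  then have "card (cyclic_orders H) \<noteq> 0" by simp
  then have cyc: "finite (cyclic_orders H)" "cyclic_orders H \<noteq> {}"
    using card.infinite by fastforce+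
  have count: "real (cyclic_count D H) = fact (card H - 1) * cycle_integral C"
    using C facts(1) ne unfolding H_def D_def by (rule cyclic_count_eq_cycle_integral)
  have "prob1 G E v = card (cyclic_orders H \<inter> {\<theta>. one_face G (rearrange G E v \<theta>)}) / card (cyclic_orders H)"
    unfolding prob1_def using cyc by (simp add: measure_pmf_of_set flip: H_def)
  also have "cyclic_orders H \<inter> {\<theta>. one_face G (rearrange G E v \<theta>)} =
      {\<theta> \<in> cyclic_orders H. cyclic_on (D \<circ> \<theta>) H}"
    using facts(4) by (auto simp: cyclic_orders_def)
  also have "real (card \<dots>) / card (cyclic_orders H) = cycle_integral C"
    using count by (simp add: card cyclic_count_def)
  finally show "prob1 G E v = cycle_integral C" .
  have "pi_at G E v \<in> {\<theta> \<in> cyclic_orders H. cyclic_on (D \<circ> \<theta>) H}" using facts by simp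
  then have "cyclic_count D H \<noteq> 0" using cyc unfolding cyclic_count_def by auto
  then show "cycle_integral C \<noteq> 0" using count by auto
qed

theorem theorem3p4:
  fixes G :: "'v half_edge_graph" and E :: embedding
  assumes "is_graph G" and "embedding_of G E" and "one_face G E"
  shows "(\<forall>v\<in>verts G. \<forall>(k::nat) (a::nat \<Rightarrow> nat).
            deg G v = k \<and> has_cycle_type (D_at G E v) (incident G v) a \<longrightarrow>
              2 / (real (deg G v) - real (a 1) + 2) \<le> prob1 G E v \<and>
              prob1 G E v \<le> 2 / (real (deg G v) - real (a 1) + 19 / 29)) \<and>
         (\<forall>v\<in>verts G. prob1 G E v \<ge> 2 / (real (deg G v) + 2))"
proof -
  have main: "2 / (real (deg G v) - real n + 2) \<le> prob1 G E v \<and>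
      prob1 G E v \<le> 2 / (real (deg G v) - real n + 19 / 29) \<and> n \<le> deg G v \<and> deg G v \<ge> 1"
    if v: "v \<in> verts G" and n: "n = card {A \<in> orbit (D_at G E v) ` incident G v. card A = 1}" for v n
  proof -
    let ?H = "incident G v" and ?D = "D_at G E v"
    note facts = one_face_rearrange_iff[OF assms v]
    have fin: "finite ?H" by (simp add: incident_def half_edges_def)
    have "?H \<noteq> {}" using facts(2) by (auto simp: cyclic_orders_def cyclic_on_def)
    then have "deg G v \<ge> 1" using fin by (simp add: deg_def Suc_le_eq card_gt_0_iff)
    moreover obtain C where C: "cycle_lists ?D ?H C"
      using fin facts(1) by (rule cycle_lists_exists)
    moreover have "card {A \<in> orbit ?D ` ?H. card A = 1} \<le> card (orbit ?D ` ?H)"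
      using fin by (intro card_mono) auto
    then have "n \<le> deg G v" using card_image_le[OF fin, of "orbit ?D"] by (simp add: n deg_def)
    ultimately show ?thesis
      using cycle_integral_bounds[OF C] prob1_eq_cycle_integral[OF assms v C]
      by (simp add: n deg_def card_fixed_points_cycle_lists)
  qed
  show ?thesis
  proof (intro conjI ballI allI impI)
    fix v k a
    assume v: "v \<in> verts G" and "deg G v = k \<and> has_cycle_type (D_at G E v) (incident G v) a"
    moreover have "deg G v \<ge> 1" using main[OF v refl] by simp
    ultimately have "a 1 = card {A \<in> orbit (D_at G E v) ` incident G v. card A = 1}"
      by (auto simp: has_cycle_type_def deg_def)
    from main[OF v this] show "2 / (real (deg G v) - real (a 1) + 2) \<le> prob1 G E v"
      "prob1 G E v \<le> 2 / (real (deg G v) - real (a 1) + 19 / 29)" by simp_all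
  next
    fix v assume v: "v \<in> verts G"
    define n where "n = card {A \<in> orbit (D_at G E v) ` incident G v. card A = 1}"
    have "2 / (real (deg G v) + 2) \<le> 2 / (real (deg G v) - real n + 2)"
      using main[OF v n_def] by (intro divide_left_mono) auto
    also have "\<dots> \<le> prob1 G E v" using main[OF v n_def] by simp
    finally show "2 / (real (deg G v) + 2) \<le> prob1 G E v" .
  qed
qed

end
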